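(* Let $D\ge 3$ be odd. For $r=0,1,\dots,D-1$ let $B_r$ be an orthonormal basis of $\mathcal L_r$ consisting of real vectors, let $N_r=\{r,r+1,\dots,D\}$ if $r$ is even and $N_r=\{r,r+1,\dots,D-1\}$ if $r$ is odd, and let $\mathcal B_2=\{(r,\xi,i): 0\le r\le D-1,\ \xi\in B_r,\ i\in N_r\}$. For $(r,\xi,i)\in\mathcal B_2$ define $u_{r,\xi,i}=\binom{2D-2r}{i-r}^{-1/2}M^r_{i,r}\xi$ if $r\le i\le D-1$, and $u_{r,\xi,D}=\frac{\sqrt2}{2}\binom{2D-2r}{D-r}^{-1/2}M^r_{D,r}\xi$ if $i=D$ ($r$ even). Let $U_2$ be the $X\times\mathcal B_2$ matrix whose $(r,\xi,i)$-column is $u_{r,\xi,i}$. Then $U_2$ gives a block-diagonalization of the Terwilliger algebra $T$: the columns of $U_2$ form an orthonormal basis of $\mathbb C^X$, and for every $M\in T$ the entry of $U_2^{\mathrm T}MU_2$ in position $((r,\xi,i),(r',\xi',j))$ vanishes unless $(r,\xi)=(r',\xi')$, each block (rows and columns indexed by $N_r$) depending only on $r$. Moreover $T$ is isomorphic to $\bigoplus_{r=0}^{D-1}\mathbb C^{N_r\times N_r}$.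
   Context: Let $S=\{1,\dots,2D\}$, $X$ the set of unordered pairs $\{u,u'\}$ of subsets of $S$ with $u\cap u'=\emptyset$, $u\cup u'=S$. The folded cube $\square_{2D}$ is the graph on $X$ with distance $\partial(x,y)=\min\{|x_1\triangle y_1|,|x_1\triangle y_2|\}$ for $x=\{x_1,x_2\},y=\{y_1,y_2\}$ (adjacent iff distance $1$); its diameter is $D$. Let $\mathbf 0=\{\emptyset,S\}$. Write each vertex as $x=(x_1,x_2)$ with parts labeled so that $|x_1|\le|x_2|$ (arbitrarily if $|x_1|=|x_2|=D$). For $x,y\in X$ put $\partial(\mathbf 0,x,y)=(i,j,t)$ where $i=|x_1|$, $j=|y_1|$ and $t=|x_1\cap y_1|$ if $i,j\le D-1$; $t=\max\{|x_1\cap y_1|,|x_2\cap y_1|\}$ if $i=D$, $j\le D-1$; $t=\max\{|x_1\cap y_1|,|x_1\cap y_2|\}$ if $i\le D-1$, $j=D$ or if $i=j=D$. Let $\mathcal I=\{(i,j,t): 0\le t\le i,j\le D,\ i+j-t\le 2D-2,\ t\ge\lfloor (j+1)/2\rfloor \text{ if } i=D,\ t\ge\lfloor (i+1)/2\rfloor\text{ if } j=D\}$. For $(i,j,t)\in\mathcal I$, $M^t_{i,j}$ is the $X\times X$ matrix with $(x,y)$-entry $1$ if $\partial(\mathbf 0,x,y)=(i,j,t)$ and $0$ otherwise. For $0\le r\le D$, $\mathcal L_r=\{\xi\in\mathbb C^X: \xi_x=0 \text{ whenever } |x_1|\neq r,\ M^{r-1}_{r-1,r}\xi=0\}$ (for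 $r=0$ the second condition is void). $A_k$ is the distance-$k$ matrix, $E^*_k$ the diagonal matrix with $(y,y)$-entry $1$ iff $\partial(\mathbf 0,y)=k$, and the Terwilliger algebra $T$ (with respect to $\mathbf 0$) is the subalgebra of $\mathrm{Mat}_X(\mathbb C)$ generated by $A_0,\dots,A_D,E^*_0,\dots,E^*_D$.
   Formalization: For the column (r,i)=(0,D) the factor √2/2 is replaced by √2, since M^0_{D,0}ξ has squared norm binom(2D,D)/2 and the stated factor would give a column of norm 1/2; all else is as stated. *)

theory Defs
  imports Complex_Main "HOL-Library.Function_Algebras"
begin

section \<open>Vectors and matrices indexed by sets\<close>

text \<open>
  The index sets below depend on a natural number, so vectors and matrices are functions on the
  ambient index type that vanish outside the index set.
\<close>

global_interpretation cfun: vector_space "\<lambda>(c::complex) (v::'a \<Rightarrow> complex) x. c * v x"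
  defines cspan = cfun.span and cdependent = cfun.dependent
  by unfold_locales (auto simp: fun_eq_iff algebra_simps)

definition vecs :: "'a set \<Rightarrow> ('a \<Rightarrow> complex) set" where
  "vecs I = {v. \<forall>x. x \<notin> I \<longrightarrow> v x = 0}"

definition cinner :: "'a set \<Rightarrow> ('a \<Rightarrow> complex) \<Rightarrow> ('a \<Rightarrow> complex) \<Rightarrow> complex" where
  "cinner I v w = (\<Sum>x\<in>I. v x * cnj (w x))"

definition orthonormal_basis :: "'a set \<Rightarrow> ('a \<Rightarrow> complex) set \<Rightarrow> ('a \<Rightarrow> complex) set \<Rightarrow> bool" where
  "orthonormal_basis I V B \<longleftrightarrow>
     \<not> cdependent B \<and> cspan B = V \<and>
     (\<forall>v\<in>B. \<forall>w\<in>B. cinner I v w = (if v = w then 1 else 0))"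

definition mats :: "'a set \<Rightarrow> ('a \<Rightarrow> 'a \<Rightarrow> complex) set" where
  "mats I = {M. \<forall>x y. x \<notin> I \<or> y \<notin> I \<longrightarrow> M x y = 0}"

definition mat_mult ::
  "'b set \<Rightarrow> ('a \<Rightarrow> 'b \<Rightarrow> complex) \<Rightarrow> ('b \<Rightarrow> 'c \<Rightarrow> complex) \<Rightarrow> 'a \<Rightarrow> 'c \<Rightarrow> complex" where
  "mat_mult I M N = (\<lambda>x y. \<Sum>z\<in>I. M x z * N z y)"

definition mat_vec :: "'b set \<Rightarrow> ('a \<Rightarrow> 'b \<Rightarrow> complex) \<Rightarrow> ('b \<Rightarrow> complex) \<Rightarrow> 'a \<Rightarrow> complex" where
  "mat_vec I M v = (\<lambda>x. \<Sum>y\<in>I. M x y * v y)"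

definition mat_transpose :: "('a \<Rightarrow> 'b \<Rightarrow> complex) \<Rightarrow> 'b \<Rightarrow> 'a \<Rightarrow> complex" where
  "mat_transpose M = (\<lambda>x y. M y x)"

definition mat_one :: "'a set \<Rightarrow> 'a \<Rightarrow> 'a \<Rightarrow> complex" where
  "mat_one I = (\<lambda>x y. if x \<in> I \<and> x = y then 1 else 0)"

definition mat_scale :: "complex \<Rightarrow> ('a \<Rightarrow> 'b \<Rightarrow> complex) \<Rightarrow> 'a \<Rightarrow> 'b \<Rightarrow> complex" where
  "mat_scale c M = (\<lambda>x y. c * M x y)"

definition mat_subalgebra :: "'a set \<Rightarrow> ('a \<Rightarrow> 'a \<Rightarrow> complex) set \<Rightarrow> bool" where
  "mat_subalgebra I A \<longleftrightarrow>
     A \<subseteq> mats I \<and> mat_one I \<in> A \<and>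
     (\<forall>M\<in>A. \<forall>N\<in>A. M + N \<in> A \<and> mat_mult I M N \<in> A) \<and>
     (\<forall>c. \<forall>M\<in>A. mat_scale c M \<in> A)"

definition generated_algebra ::
  "'a set \<Rightarrow> ('a \<Rightarrow> 'a \<Rightarrow> complex) set \<Rightarrow> ('a \<Rightarrow> 'a \<Rightarrow> complex) set" where
  "generated_algebra I G = \<Inter>{A. mat_subalgebra I A \<and> G \<subseteq> A}"


section \<open>Direct sums of full matrix algebras\<close>

text \<open>An element of the direct sum over \<open>r \<in> R\<close> is the family \<open>F\<close> of its blocks.\<close>

definition block_sum :: "'r set \<Rightarrow> ('r \<Rightarrow> 'a set) \<Rightarrow> ('r \<Rightarrow> 'a \<Rightarrow> 'a \<Rightarrow> complex) set" where
  "block_sum R N = {F. (\<forall>r\<in>R. F r \<in> mats (N r)) \<and> (\<forall>r. r \<notin> R \<longrightarrow> F r = 0)}"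

definition block_mult :: "('r \<Rightarrow> 'a set) \<Rightarrow> ('r \<Rightarrow> 'a \<Rightarrow> 'a \<Rightarrow> complex) \<Rightarrow>
    ('r \<Rightarrow> 'a \<Rightarrow> 'a \<Rightarrow> complex) \<Rightarrow> 'r \<Rightarrow> 'a \<Rightarrow> 'a \<Rightarrow> complex" where
  "block_mult N F G = (\<lambda>r. mat_mult (N r) (F r) (G r))"

definition block_one :: "'r set \<Rightarrow> ('r \<Rightarrow> 'a set) \<Rightarrow> 'r \<Rightarrow> 'a \<Rightarrow> 'a \<Rightarrow> complex" where
  "block_one R N = (\<lambda>r. if r \<in> R then mat_one (N r) else 0)"

definition isomorphic_to_block_sum ::
  "'a set \<Rightarrow> ('a \<Rightarrow> 'a \<Rightarrow> complex) set \<Rightarrow> 'r set \<Rightarrow> ('r \<Rightarrow> 'b set) \<Rightarrow> bool" where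
  "isomorphic_to_block_sum I A R N \<longleftrightarrow>
     (\<exists>\<phi>. bij_betw \<phi> A (block_sum R N) \<and>
        (\<forall>M\<in>A. \<forall>M'\<in>A. \<phi> (M + M') = \<phi> M + \<phi> M') \<and>
        (\<forall>c. \<forall>M\<in>A. \<phi> (mat_scale c M) = (\<lambda>r. mat_scale c (\<phi> M r))) \<and>
        (\<forall>M\<in>A. \<forall>M'\<in>A. \<phi> (mat_mult I M M') = block_mult N (\<phi> M) (\<phi> M')) \<and>
        \<phi> (mat_one I) = block_one R N)"


section \<open>The folded cube and its Terwilliger algebra\<close>

type_synonym vertex = "nat set set"

definition ground :: "nat \<Rightarrow> nat set" where
  "ground D = {1..2 * D}"

definition fc_verts :: "nat \<Rightarrow> vertex set" where
  "fc_verts D = {{u, u'} | u u'. u \<inter> u' = {} \<and> u \<union> u' = ground D}"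

definition fc_zero :: "nat \<Rightarrow> vertex" where
  "fc_zero D = {{}, ground D}"

text \<open>
  A labelling writes each vertex \<open>x\<close> as \<open>(x\<^sub>1, x\<^sub>2)\<close> with \<open>|x\<^sub>1| \<le> |x\<^sub>2|\<close>, arbitrarily in
  case of equality. It is a parameter of all notions below.
\<close>

definition fc_labelling :: "nat \<Rightarrow> (vertex \<Rightarrow> nat set \<times> nat set) \<Rightarrow> bool" where
  "fc_labelling D p \<longleftrightarrow>
     (\<forall>x\<in>fc_verts D. x = {fst (p x), snd (p x)} \<and> card (fst (p x)) \<le> card (snd (p x)))"

definition fc_dist :: "(vertex \<Rightarrow> nat set \<times> nat set) \<Rightarrow> vertex \<Rightarrow> vertex \<Rightarrow> nat" where
  "fc_dist p x y = min (card (sym_diff (fst (p x)) (fst (p y))))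
                       (card (sym_diff (fst (p x)) (snd (p y))))"

text \<open>The triple \<open>\<partial>(0, x, y) = (i, j, t)\<close>.\<close>

definition fc_triple ::
  "nat \<Rightarrow> (vertex \<Rightarrow> nat set \<times> nat set) \<Rightarrow> vertex \<Rightarrow> vertex \<Rightarrow> nat \<times> nat \<times> nat" where
  "fc_triple D p x y =
     (let (x1, x2) = p x; (y1, y2) = p y; i = card x1; j = card y1
      in (i, j,
          if i < D \<and> j < D then card (x1 \<inter> y1)
          else if i = D \<and> j < D then max (card (x1 \<inter> y1)) (card (x2 \<inter> y1))
          else max (card (x1 \<inter> y1)) (card (x1 \<inter> y2))))"

text \<open>\<open>fc_M D p i j t\<close> is \<open>M\<^sup>t\<^sub>i\<^sub>,\<^sub>j\<close>.\<close>

definition fc_M :: "nat \<Rightarrow> (vertex \<Rightarrow> nat set \<times> nat set) \<Rightarrow> nat \<Rightarrow> nat \<Rightarrow> nat \<Rightarrow>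
    vertex \<Rightarrow> vertex \<Rightarrow> complex" where
  "fc_M D p i j t = (\<lambda>x y.
     if x \<in> fc_verts D \<and> y \<in> fc_verts D \<and> fc_triple D p x y = (i, j, t) then 1 else 0)"

definition fc_L :: "nat \<Rightarrow> (vertex \<Rightarrow> nat set \<times> nat set) \<Rightarrow> nat \<Rightarrow> (vertex \<Rightarrow> complex) set" where
  "fc_L D p r = {\<xi> \<in> vecs (fc_verts D).
     (\<forall>x\<in>fc_verts D. card (fst (p x)) \<noteq> r \<longrightarrow> \<xi> x = 0) \<and>
     (r \<noteq> 0 \<longrightarrow> mat_vec (fc_verts D) (fc_M D p (r - 1) r (r - 1)) \<xi> = 0)}"

definition fc_A :: "nat \<Rightarrow> (vertex \<Rightarrow> nat set \<times> nat set) \<Rightarrow> nat \<Rightarrow> vertex \<Rightarrow> vertex \<Rightarrow> complex" where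
  "fc_A D p k = (\<lambda>x y.
     if x \<in> fc_verts D \<and> y \<in> fc_verts D \<and> fc_dist p x y = k then 1 else 0)"

definition fc_Estar ::
  "nat \<Rightarrow> (vertex \<Rightarrow> nat set \<times> nat set) \<Rightarrow> nat \<Rightarrow> vertex \<Rightarrow> vertex \<Rightarrow> complex" where
  "fc_Estar D p k = (\<lambda>x y.
     if x \<in> fc_verts D \<and> x = y \<and> fc_dist p (fc_zero D) y = k then 1 else 0)"

definition terwilliger ::
  "nat \<Rightarrow> (vertex \<Rightarrow> nat set \<times> nat set) \<Rightarrow> (vertex \<Rightarrow> vertex \<Rightarrow> complex) set" where
  "terwilliger D p = generated_algebra (fc_verts D) (fc_A D p ` {0..D} \<union> fc_Estar D p ` {0..D})"


section \<open>The block-diagonalizing matrix\<close>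

definition fc_N :: "nat \<Rightarrow> nat \<Rightarrow> nat set" where
  "fc_N D r = (if even r then {r..D} else {r..D - 1})"

definition fc_B2 ::
  "nat \<Rightarrow> (nat \<Rightarrow> (vertex \<Rightarrow> complex) set) \<Rightarrow> (nat \<times> (vertex \<Rightarrow> complex) \<times> nat) set" where
  "fc_B2 D B = {(r, \<xi>, i). r \<le> D - 1 \<and> \<xi> \<in> B r \<and> i \<in> fc_N D r}"

text \<open>
  The normalizing factor of \<open>M\<^sup>r\<^sub>i\<^sub>,\<^sub>r \<xi>\<close>. For \<open>i = D\<close> and \<open>r \<ge> 1\<close> the factor
  \<open>sqrt 2 / 2\<close> arises because \<open>M\<^sup>r\<^sub>D\<^sub>,\<^sub>r\<close> sums over the \<open>r\<close>-subsets of both parts of a vertex,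
  which are disjoint families. For \<open>r = 0\<close> these families coincide (both consist of the empty
  set), the 0/1 matrix \<open>M\<^sup>0\<^sub>D\<^sub>,\<^sub>0\<close> counts the empty set only once, and \<open>M\<^sup>0\<^sub>D\<^sub>,\<^sub>0 \<xi>\<close> has squared
  norm \<open>(2D choose D) / 2\<close>; the factor \<open>sqrt 2 / 2\<close> would give a vector of norm \<open>1 / 2\<close>, so the
  unit vector requires \<open>sqrt 2\<close> there.
\<close>

definition fc_factor :: "nat \<Rightarrow> nat \<Rightarrow> nat \<Rightarrow> real" where
  "fc_factor D r i =
     (if i < D then 1 else if r = 0 then sqrt 2 else sqrt 2 / 2) *
     real ((2 * D - 2 * r) choose (i - r)) powr (- 1 / 2)"

definition fc_u :: "nat \<Rightarrow> (vertex \<Rightarrow> nat set \<times> nat set) \<Rightarrow> nat \<Rightarrow> (vertex \<Rightarrow> complex) \<Rightarrow> nat \<Rightarrow>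
    vertex \<Rightarrow> complex" where
  "fc_u D p r \<xi> i =
     (\<lambda>x. complex_of_real (fc_factor D r i) * mat_vec (fc_verts D) (fc_M D p i r r) \<xi> x)"

definition fc_U2 :: "nat \<Rightarrow> (vertex \<Rightarrow> nat set \<times> nat set) \<Rightarrow>
    vertex \<Rightarrow> nat \<times> (vertex \<Rightarrow> complex) \<times> nat \<Rightarrow> complex" where
  "fc_U2 D p = (\<lambda>x (r, \<xi>, i). fc_u D p r \<xi> i x)"

end

theory Submission
  imports Defs
begin

text \<open>
  Lifted to subsets of the ground set \<open>S\<close>, a vector \<open>\<xi> \<in> \<L>\<^sub>r\<close> is a harmonic function on
  \<open>r\<close>-subsets, and \<open>M\<^sup>r\<^sub>i\<^sub>,\<^sub>r \<xi>\<close> sums it over the \<open>r\<close>-subsets of an \<open>i\<close>-subset. Harmonicity implies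
  that these sums are multiplied by \<open>(-1)\<^sup>r\<close> under complementation; this is why level \<open>D\<close> only
  occurs for even \<open>r\<close> and why \<open>\<L>\<^sub>D = 0\<close> for odd \<open>D\<close>. It also yields a symmetric three-term
  recurrence \<open>A\<^sub>1 u\<^sub>i = \<alpha>\<^sub>i u\<^sub>i\<^sub>+\<^sub>1 + \<alpha>\<^sub>i\<^sub>-\<^sub>1 u\<^sub>i\<^sub>-\<^sub>1\<close> with nonzero coefficients that depend only on
  \<open>r\<close> and \<open>i\<close>. Since \<open>A\<^sub>1\<close> is symmetric, orthonormality and completeness of the \<open>u\<close> propagate
  from each level to the next along this recurrence. Every \<open>A\<^sub>k\<close> is a polynomial in \<open>A\<^sub>1\<close>, so \<open>T\<close> is
  block-diagonal; and the tridiagonal blocks of \<open>A\<^sub>1\<close> together with the \<open>E\<^sup>*\<^sub>k\<close> generate all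
  matrix units, because the blocks have pairwise different lowest indices.
\<close>

section \<open>Harmonic functions on subsets\<close>

text \<open>The sign under complementation comes from sorting the \<open>r\<close>-subsets by the
  size of their intersection with a fixed set: harmonicity ties consecutive classes together. The
  obstacle is level \<open>D\<close>, where a vertex has two halves of equal size and the labelling
  picks one arbitrarily. Computing with any half \<open>w\<close>, where \<open>w\<close> and
  \<open>S - w\<close> name the same vertex, removes the choice. Seen from a \<open>D\<close>-set,
  adding a point amounts to removing one from the other half; the two contributions to
  \<open>A\<^sub>1\<close> double for even \<open>r\<close> and cancel for odd \<open>r\<close>. The
  doubling is the source of the 2 in \<open>alpha\<close> and is balanced by the
  \<open>sqrt 2\<close> in \<open>kappa\<close>. No norm of a lifted vector is computed and no
  dimension is counted: unit length starts from \<xi> itself, the binomial normalization is exactly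
  what makes the recurrence symmetric, and completeness is shown through the orthogonal complement.
  The isomorphism also needs every \<open>\<L>\<^sub>r\<close> with \<open>r < D\<close> to be
  nonzero, which takes an explicit witness.\<close>

definition subset_sum :: "(nat set \<Rightarrow> complex) \<Rightarrow> nat \<Rightarrow> nat set \<Rightarrow> complex" where
  "subset_sum g r w = (\<Sum>y | y \<subseteq> w \<and> card y = r. g y)"

text \<open>The kernel of the lowering operator on \<open>r\<close>-subsets. Writing
  \<open>Suc (card y) = r\<close> avoids \<open>r - 1\<close>, so the condition is void for
  \<open>r = 0\<close>, as it is for \<open>\<L>\<^sub>0\<close>.\<close>

definition harmonic :: "nat set \<Rightarrow> nat \<Rightarrow> (nat set \<Rightarrow> complex) \<Rightarrow> bool" where
  "harmonic S r g \<longleftrightarrow> (\<forall>y\<subseteq>S. Suc (card y) = r \<longrightarrow> (\<Sum>z\<in>S - y. g (insert z y)) = 0)"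

lemma finite_subsets_card [simp]: "finite w \<Longrightarrow> finite {y. y \<subseteq> w \<and> card y = r}"
  by (rule finite_subset[of _ "Pow w"]) auto

text \<open>Double counting of nested pairs of subsets of \<open>W\<close> with sizes
  \<open>k\<close> and \<open>Suc k\<close>: a pair is given by the smaller set and the added point,
  or by the larger set and the removed point.\<close>

lemma sum_insert_eq_sum_remove:
  fixes F :: "nat set \<Rightarrow> nat \<Rightarrow> complex"
  assumes "finite W"
  shows "(\<Sum>y | y \<subseteq> W \<and> card y = k. \<Sum>z\<in>W - y. F y z) =
         (\<Sum>y | y \<subseteq> W \<and> card y = Suc k. \<Sum>z\<in>y. F (y - {z}) z)"
proof -
  have fin: "\<And>y. y \<subseteq> W \<Longrightarrow> finite y" using assms finite_subset by blast
  have "(\<Sum>y | y \<subseteq> W \<and> card y = k. \<Sum>z\<in>W - y. F y z) =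
        (\<Sum>(y, z)\<in>Sigma {y. y \<subseteq> W \<and> card y = k} (\<lambda>y. W - y). F y z)"
    using assms by (subst sum.Sigma) auto
  also have "\<dots> = (\<Sum>(y, z)\<in>Sigma {y. y \<subseteq> W \<and> card y = Suc k} (\<lambda>y. y). F (y - {z}) z)"
    by (rule sum.reindex_bij_witness[where i = "\<lambda>(y, z). (y - {z}, z)"
          and j = "\<lambda>(y, z). (insert z y, z)"])
       (auto simp: fin insert_absorb)
  also have "\<dots> = (\<Sum>y | y \<subseteq> W \<and> card y = Suc k. \<Sum>z\<in>y. F (y - {z}) z)"
    using assms by (subst sum.Sigma) (auto simp: fin)
  finally show ?thesis .
qed

lemma subset_sum_eq_0: "finite w \<Longrightarrow> card w < r \<Longrightarrow> subset_sum g r w = 0"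
  unfolding subset_sum_def by (rule sum.neutral) (auto dest: card_mono)

lemma subset_sum_card:
  assumes "finite w"
  shows "subset_sum g (card w) w = g w"
proof -
  have "{y. y \<subseteq> w \<and> card y = card w} = {w}"
    using assms by (auto dest: card_subset_eq)
  then show ?thesis by (simp add: subset_sum_def)
qed

text \<open>An \<open>r\<close>-subset of \<open>w\<close> survives the removal of each point
  outside it. The factor is a difference of complex numbers, so \<open>card w < r\<close> is covered
  as well: both sides are then zero.\<close>

lemma sum_subset_sum_remove:
  assumes "finite w"
  shows "(\<Sum>z\<in>w. subset_sum g r (w - {z})) = (of_nat (card w) - of_nat r) * subset_sum g r w"
proof -
  have fin: "\<And>y. y \<subseteq> w \<Longrightarrow> finite y" using assms finite_subset by blast
  have "(\<Sum>z\<in>w. subset_sum g r (w - {z})) =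
        (\<Sum>z\<in>w. \<Sum>y\<in>{y \<in> {y. y \<subseteq> w \<and> card y = r}. z \<notin> y}. g y)"
    unfolding subset_sum_def by (intro sum.cong) auto
  also have "\<dots> = (\<Sum>y | y \<subseteq> w \<and> card y = r. \<Sum>z\<in>{z \<in> w. z \<notin> y}. g y)"
    using assms by (intro sum.swap_restrict) auto
  also have "\<dots> = (\<Sum>y | y \<subseteq> w \<and> card y = r. (of_nat (card w) - of_nat r) * g y)"
  proof (intro sum.cong refl)
    fix y assume "y \<in> {y. y \<subseteq> w \<and> card y = r}"
    then have y: "y \<subseteq> w" "card y = r" by auto
    have "{z \<in> w. z \<notin> y} = w - y" by auto
    moreover have "card (w - y) = card w - r" "r \<le> card w"
      using y assms fin by (auto simp: card_Diff_subset card_mono)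
    ultimately show "(\<Sum>z\<in>{z \<in> w. z \<notin> y}. g y) = (of_nat (card w) - of_nat r) * g y"
      by (simp add: of_nat_diff)
  qed
  finally show ?thesis by (simp add: subset_sum_def sum_distrib_left)
qed

lemma subset_sum_insert:
  assumes "finite w" "z \<notin> w"
  shows "subset_sum g r (insert z w) =
         subset_sum g r w + (\<Sum>y | y \<subseteq> w \<and> Suc (card y) = r. g (insert z y))"
proof -
  have fin: "\<And>y. y \<subseteq> w \<Longrightarrow> finite y" using assms finite_subset by blast
  have eq: "{y. y \<subseteq> insert z w \<and> card y = r} =
     {y. y \<subseteq> w \<and> card y = r} \<union> insert z ` {y. y \<subseteq> w \<and> Suc (card y) = r}" (is "?A = ?B")
  proof
    show "?A \<subseteq> ?B"
    proof
      fix y assume y: "y \<in> ?A"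
      show "y \<in> ?B"
      proof (cases "z \<in> y")
        case True
        then have "y = insert z (y - {z})" "y - {z} \<subseteq> w" "Suc (card (y - {z})) = r"
          using y assms finite_subset[of y "insert z w"] card_Suc_Diff1[of y z] by auto
        then show ?thesis by blast
      qed (use y in auto)
    qed
    show "?B \<subseteq> ?A" using assms fin by (auto simp: card_insert_if)
  qed
  have fin2: "finite {y. y \<subseteq> w \<and> Suc (card y) = r}"
    using assms by (auto intro: finite_subset[of _ "Pow w"])
  have "inj_on (insert z) {y. y \<subseteq> w \<and> Suc (card y) = r}"
    using assms by (auto simp: inj_on_def insert_ident subset_iff)
  moreover have "{y. y \<subseteq> w \<and> card y = r} \<inter> insert z ` {y. y \<subseteq> w \<and> Suc (card y) = r} = {}"
    using assms by auto
  ultimately show ?thesis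
    unfolding subset_sum_def eq using assms fin2
    by (subst sum.union_disjoint) (auto simp: sum.reindex)
qed

text \<open>Subsets of \<open>insert z w\<close> that avoid \<open>z\<close> contribute
  \<open>card S - card w\<close> copies of the sum over \<open>w\<close>. For those containing
  \<open>z\<close>, harmonicity trades the points outside \<open>w\<close> for minus the points of
  \<open>w\<close>, and each \<open>r\<close>-subset of \<open>w\<close> is then obtained once for
  each of its \<open>r\<close> points.\<close>

lemma sum_subset_sum_insert:
  assumes S: "finite S" "w \<subseteq> S" and g: "harmonic S r g"
  shows "(\<Sum>z\<in>S - w. subset_sum g r (insert z w)) =
         (of_nat (card S) - of_nat (card w) - of_nat r) * subset_sum g r w"
proof -
  have finw: "finite w" using S finite_subset by blast
  have fin: "\<And>y. y \<subseteq> w \<Longrightarrow> finite y" using finw finite_subset by blast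
  have "(\<Sum>z\<in>S - w. \<Sum>y | y \<subseteq> w \<and> Suc (card y) = r. g (insert z y)) = - of_nat r * subset_sum g r w"
  proof (cases r)
    case (Suc k)
    have "(\<Sum>z\<in>S - w. \<Sum>y | y \<subseteq> w \<and> Suc (card y) = r. g (insert z y)) =
          (\<Sum>y | y \<subseteq> w \<and> card y = k. \<Sum>z\<in>S - w. g (insert z y))"
      using Suc by (subst sum.swap) simp
    also have "\<dots> = (\<Sum>y | y \<subseteq> w \<and> card y = k. - (\<Sum>z\<in>w - y. g (insert z y)))"
    proof (intro sum.cong refl)
      fix y assume y: "y \<in> {y. y \<subseteq> w \<and> card y = k}"
      have "(\<Sum>z\<in>S - y. g (insert z y)) = 0"
        using g y S Suc by (auto simp: harmonic_def)
      moreover have "S - y = (S - w) \<union> (w - y)" using y S by auto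
      moreover have "(S - w) \<inter> (w - y) = {}" by auto
      ultimately show "(\<Sum>z\<in>S - w. g (insert z y)) = - (\<Sum>z\<in>w - y. g (insert z y))"
        using S finw by (simp add: sum.union_disjoint eq_neg_iff_add_eq_0)
    qed
    also have "\<dots> = - (\<Sum>y | y \<subseteq> w \<and> card y = Suc k. \<Sum>z\<in>y. g (insert z (y - {z})))"
      by (simp only: sum_negf sum_insert_eq_sum_remove[OF finw, where F = "\<lambda>y z. g (insert z y)"])
    also have "\<dots> = - (\<Sum>y | y \<subseteq> w \<and> card y = Suc k. of_nat r * g y)"
      using Suc by (auto simp: insert_absorb)
    finally show ?thesis
      by (simp only: subset_sum_def sum_distrib_left[symmetric] Suc mult_minus_left)
  qed simp
  moreover have "(\<Sum>z\<in>S - w. subset_sum g r (insert z w)) =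
     of_nat (card S - card w) * subset_sum g r w +
     (\<Sum>z\<in>S - w. \<Sum>y | y \<subseteq> w \<and> Suc (card y) = r. g (insert z y))"
    using S finw by (simp add: subset_sum_insert sum.distrib card_Diff_subset)
  moreover have "of_nat (card S - card w) = (of_nat (card S) - of_nat (card w) :: complex)"
    using S by (simp add: of_nat_diff card_mono)
  ultimately show ?thesis by (simp add: algebra_simps)
qed

text \<open>Let \<open>h k\<close> be the sum over the \<open>r\<close>-subsets of \<open>S\<close>
  with exactly \<open>k\<close> points in \<open>w\<close>. A two-term recurrence in
  \<open>k\<close> connects \<open>h r\<close>, the sum over subsets of \<open>w\<close>, with
  \<open>h 0\<close>, the sum over subsets of \<open>S - w\<close>.\<close>

lemma subset_sum_compl:
  assumes S: "finite S" "w \<subseteq> S" and g: "harmonic S r g"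
  shows "subset_sum g r (S - w) = (-1) ^ r * subset_sum g r w"
proof -
  define h where "h k = (\<Sum>y | y \<subseteq> S \<and> card y = r. if card (y \<inter> w) = k then g y else 0)" for k
  have fin: "\<And>y. y \<subseteq> S \<Longrightarrow> finite y" using S finite_subset by blast
  \<comment> \<open>Harmonicity is summed over the \<open>(r - 1)\<close>-sets with \<open>k\<close>
    points in \<open>w\<close>. An \<open>r\<close>-set leads to one of these by losing one of its
    \<open>r - k\<close> points outside \<open>w\<close>, or one of its \<open>Suc k\<close> points
    inside.\<close>
  have step: "of_nat (r - k) * h k + of_nat (Suc k) * h (Suc k) = 0" if "k < r" for k
  proof -
    obtain m where m: "r = Suc m" using \<open>k < r\<close> gr0_implies_Suc[of r] by auto
    have "0 = (\<Sum>y | y \<subseteq> S \<and> card y = m. if card (y \<inter> w) = k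
                 then \<Sum>z\<in>S - y. g (insert z y) else 0)"
      using g m by (intro sum.neutral[symmetric]) (auto simp: harmonic_def)
    also have "\<dots> = (\<Sum>y | y \<subseteq> S \<and> card y = m. \<Sum>z\<in>S - y.
                 if card (y \<inter> w) = k then g (insert z y) else 0)"
      by (intro sum.cong) auto
    also have "\<dots> = (\<Sum>y | y \<subseteq> S \<and> card y = r. \<Sum>z\<in>y.
                 if card ((y - {z}) \<inter> w) = k then g (insert z (y - {z})) else 0)"
      using sum_insert_eq_sum_remove[OF S(1)] m by simp
    also have "\<dots> = (\<Sum>y | y \<subseteq> S \<and> card y = r.
       of_nat (r - k) * (if card (y \<inter> w) = k then g y else 0) +
       of_nat (Suc k) * (if card (y \<inter> w) = Suc k then g y else 0))"
    proof (intro sum.cong refl)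
      fix y assume "y \<in> {y. y \<subseteq> S \<and> card y = r}"
      then have y: "y \<subseteq> S" "card y = r" "finite y" using fin by auto
      have "(\<Sum>z\<in>y. if card ((y - {z}) \<inter> w) = k then g (insert z (y - {z})) else 0) =
            (\<Sum>z\<in>y - w. if card (y \<inter> w) = k then g y else 0) +
            (\<Sum>z\<in>y \<inter> w. if card (y \<inter> w) = Suc k then g y else 0)"
      proof -
        have "(\<Sum>z\<in>y. if card ((y - {z}) \<inter> w) = k then g (insert z (y - {z})) else 0) =
          (\<Sum>z\<in>y - w. if card ((y - {z}) \<inter> w) = k then g (insert z (y - {z})) else 0) +
          (\<Sum>z\<in>y \<inter> w. if card ((y - {z}) \<inter> w) = k then g (insert z (y - {z})) else 0)"
          by (subst sum.Int_Diff[OF y(3), of _ w]) (rule add.commute)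
        also have "(\<Sum>z\<in>y - w. if card ((y - {z}) \<inter> w) = k then g (insert z (y - {z})) else 0) =
           (\<Sum>z\<in>y - w. if card (y \<inter> w) = k then g y else 0)"
        proof (intro sum.cong refl)
          fix z assume z: "z \<in> y - w"
          then have "(y - {z}) \<inter> w = y \<inter> w" "insert z (y - {z}) = y" by auto
          then show "(if card ((y - {z}) \<inter> w) = k then g (insert z (y - {z})) else 0) =
            (if card (y \<inter> w) = k then g y else 0)" by simp
        qed
        also have "(\<Sum>z\<in>y \<inter> w. if card ((y - {z}) \<inter> w) = k then g (insert z (y - {z})) else 0) =
           (\<Sum>z\<in>y \<inter> w. if card (y \<inter> w) = Suc k then g y else 0)"
        proof (intro sum.cong refl)
          fix z assume z: "z \<in> y \<inter> w"
          then have "(y - {z}) \<inter> w = y \<inter> w - {z}" "insert z (y - {z}) = y" by auto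
          moreover have "Suc (card (y \<inter> w - {z})) = card (y \<inter> w)"
            using z y by (intro card_Suc_Diff1) auto
          ultimately show "(if card ((y - {z}) \<inter> w) = k then g (insert z (y - {z})) else 0) =
            (if card (y \<inter> w) = Suc k then g y else 0)" by auto
        qed
        finally show ?thesis .
      qed
      moreover have "card (y - w) = r - card (y \<inter> w)"
        using y by (simp add: card_Diff_subset_Int)
      ultimately show "(\<Sum>z\<in>y. if card ((y - {z}) \<inter> w) = k then g (insert z (y - {z})) else 0) =
        of_nat (r - k) * (if card (y \<inter> w) = k then g y else 0) +
        of_nat (Suc k) * (if card (y \<inter> w) = Suc k then g y else 0)"
        by auto
    qed
    finally show ?thesis
      unfolding h_def by (simp add: sum.distrib sum_distrib_left)
  qed
  \<comment> \<open>The recurrence is solved downwards from \<open>h r\<close>; at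
    \<open>j = r\<close> the binomial coefficient is 1 and only the sign is left.\<close>
  have bin: "h (r - j) = (-1) ^ j * of_nat (r choose j) * h r" if "j \<le> r" for j
    using that
  proof (induction j)
    case (Suc j)
    have e: "Suc (r - Suc j) = r - j" "r - (r - Suc j) = Suc j" using Suc.prems by auto
    have "of_nat (Suc j) * h (r - Suc j) = - of_nat (r - j) * h (r - j)"
      using step[of "r - Suc j"] Suc.prems unfolding e mult_minus_left eq_neg_iff_add_eq_0 by simp
    also have "\<dots> = - of_nat (r - j) * ((-1) ^ j * of_nat (r choose j) * h r)"
      using Suc by simp
    also have "\<dots> = (-1) ^ Suc j * of_nat ((r - j) * (r choose j)) * h r"
      by simp
    also have "(r - j) * (r choose j) = Suc j * (r choose Suc j)"
      by (metis binomial_absorb_comp binomial_absorption mult.commute)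
    finally have "of_nat (Suc j) * h (r - Suc j) = 
        of_nat (Suc j) * ((-1) ^ Suc j * of_nat (r choose Suc j) * h r)"
      by (simp only: of_nat_mult ac_simps)
    then show ?case by (simp only: mult_cancel_left of_nat_eq_0_iff) simp
  qed simp
  have hr: "h r = subset_sum g r w"
  proof -
    have "h r = (\<Sum>y\<in>{y \<in> {y. y \<subseteq> S \<and> card y = r}. card (y \<inter> w) = r}. g y)"
      unfolding h_def using S by (subst sum.inter_filter) auto
    also have "{y \<in> {y. y \<subseteq> S \<and> card y = r}. card (y \<inter> w) = r} = {y. y \<subseteq> w \<and> card y = r}"
    proof -
      have "y \<subseteq> w" if "y \<subseteq> S" "card y = r" "card (y \<inter> w) = r" for y
        using that card_subset_eq[of y "y \<inter> w"] fin by auto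
      moreover have "y \<subseteq> w \<Longrightarrow> y \<inter> w = y" for y by auto
      ultimately show ?thesis using S by auto
    qed
    finally show ?thesis by (simp add: subset_sum_def)
  qed
  have h0: "h 0 = subset_sum g r (S - w)"
  proof -
    have "h 0 = (\<Sum>y\<in>{y \<in> {y. y \<subseteq> S \<and> card y = r}. card (y \<inter> w) = 0}. g y)"
      unfolding h_def using S by (subst sum.inter_filter) auto
    also have "{y \<in> {y. y \<subseteq> S \<and> card y = r}. card (y \<inter> w) = 0} = {y. y \<subseteq> S - w \<and> card y = r}"
    proof -
      have "card (y \<inter> w) = 0 \<longleftrightarrow> y \<inter> w = {}" if "y \<subseteq> S" for y
        using fin[OF that] by simp
      then show ?thesis by blast
    qed
    finally show ?thesis by (simp add: subset_sum_def)
  qed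
  show ?thesis using bin[of r] h0 hr by simp
qed

section \<open>Direct sums of matrix algebras\<close>

definition block_unit :: "'r \<Rightarrow> 'a \<Rightarrow> 'a \<Rightarrow> 'r \<Rightarrow> 'a \<Rightarrow> 'a \<Rightarrow> complex" where
  "block_unit s i j = (\<lambda>r k l. if r = s \<and> k = i \<and> l = j then 1 else 0)"

definition block_scale :: "complex \<Rightarrow> ('r \<Rightarrow> 'a \<Rightarrow> 'a \<Rightarrow> complex) \<Rightarrow> 'r \<Rightarrow> 'a \<Rightarrow> 'a \<Rightarrow> complex" where
  "block_scale c F = (\<lambda>r. mat_scale c (F r))"

text \<open>A scalar \<open>f r\<close> at index \<open>s\<close> of every block that reaches
  \<open>s\<close>. With \<open>f = 1\<close> this is the image of \<open>E\<^sup>*\<^sub>s\<close>;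
  general weights accommodate the down-up operator and its polynomials.\<close>

definition block_diag :: "'r set \<Rightarrow> ('r \<Rightarrow> 'a set) \<Rightarrow> 'a \<Rightarrow> ('r \<Rightarrow> complex) \<Rightarrow> 'r \<Rightarrow> 'a \<Rightarrow> 'a \<Rightarrow> complex" where
  "block_diag R N s f = (\<lambda>r i j. if r \<in> R \<and> s \<in> N r \<and> i = s \<and> j = s then f r else 0)"

text \<open>The image of \<open>A\<^sub>1\<close>. The weight between the indices \<open>i\<close>
  and \<open>Suc i\<close> is named by the lower one.\<close>

definition block_tridiag :: "'r set \<Rightarrow> ('r \<Rightarrow> nat set) \<Rightarrow> ('r \<Rightarrow> nat \<Rightarrow> complex) \<Rightarrow> 'r \<Rightarrow> nat \<Rightarrow> nat \<Rightarrow> complex" where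
  "block_tridiag R N a = (\<lambda>r i j. if r \<in> R \<and> i \<in> N r \<and> j \<in> N r
     then (if i = Suc j then a r j else if j = Suc i then a r i else 0) else 0)"

definition block_subalgebra :: "'r set \<Rightarrow> ('r \<Rightarrow> 'a set) \<Rightarrow> ('r \<Rightarrow> 'a \<Rightarrow> 'a \<Rightarrow> complex) set \<Rightarrow> bool" where
  "block_subalgebra R N C \<longleftrightarrow> C \<subseteq> block_sum R N \<and>
     (\<forall>F\<in>C. \<forall>G\<in>C. F + G \<in> C \<and> block_mult N F G \<in> C) \<and> (\<forall>c. \<forall>F\<in>C. block_scale c F \<in> C)"

text \<open>The closure conditions also admit the empty set, which has no zero to serve as an empty
  sum; hence \<open>A \<noteq> {}\<close>.\<close>

lemma block_subalgebra_sum: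
  assumes "block_subalgebra R N C" "finite A" "A \<noteq> {}" "\<And>a. a \<in> A \<Longrightarrow> F a \<in> C"
  shows "(\<Sum>a\<in>A. F a) \<in> C"
  using assms(2-4)
proof (induction A rule: finite_ne_induct)
  case (insert x A)
  have "F x + sum F A \<in> C" using insert assms(1) unfolding block_subalgebra_def by blast
  then show ?case by (simp only: sum.insert[OF insert.hyps(1,3)])
qed simp

section \<open>Products with matrix units and diagonal elements\<close>

lemma block_mult_unit_right:
  assumes "finite (N s)" "k \<in> N s"
  shows "block_mult N F (block_unit s k l) = (\<lambda>r i j. if r = s \<and> j = l then F s i k else 0)"
proof (intro ext)
  fix r i j
  have "(\<Sum>z\<in>N r. F r i z * (if r = s \<and> z = k \<and> j = l then 1 else 0)) =
        (\<Sum>z\<in>N r. if z = k then (if r = s \<and> j = l then F r i z else 0) else 0)"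
    by (intro sum.cong) auto
  also have "\<dots> = (if r = s \<and> j = l then F s i k else 0)"
    using assms by (cases "r = s") (auto intro: sum.neutral)
  finally show "block_mult N F (block_unit s k l) r i j = (if r = s \<and> j = l then F s i k else 0)"
    by (simp add: block_mult_def mat_mult_def block_unit_def)
qed

lemma block_mult_unit_left:
  assumes "finite (N s)" "l \<in> N s"
  shows "block_mult N (block_unit s k l) F = (\<lambda>r i j. if r = s \<and> i = k then F s l j else 0)"
proof (intro ext)
  fix r i j
  have "(\<Sum>z\<in>N r. (if r = s \<and> i = k \<and> z = l then 1 else 0) * F r z j) =
        (\<Sum>z\<in>N r. if z = l then (if r = s \<and> i = k then F r z j else 0) else 0)"
    by (intro sum.cong) auto
  also have "\<dots> = (if r = s \<and> i = k then F s l j else 0)"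
    using assms by (cases "r = s") (auto intro: sum.neutral)
  finally show "block_mult N (block_unit s k l) F r i j = (if r = s \<and> i = k then F s l j else 0)"
    by (simp add: block_mult_def mat_mult_def block_unit_def)
qed

lemma block_mult_diag_left:
  assumes "\<And>r. r \<in> R \<Longrightarrow> finite (N r)"
  shows "block_mult N (block_diag R N s f) F =
    (\<lambda>r i j. if r \<in> R \<and> s \<in> N r \<and> i = s then f r * F r s j else 0)"
proof (intro ext)
  fix r i j
  have "(\<Sum>z\<in>N r. (if r \<in> R \<and> s \<in> N r \<and> i = s \<and> z = s then f r else 0) * F r z j) =
        (\<Sum>z\<in>N r. if z = s then (if r \<in> R \<and> s \<in> N r \<and> i = s then f r * F r s j else 0) else 0)"
    by (intro sum.cong) auto
  also have "\<dots> = (if r \<in> R \<and> s \<in> N r \<and> i = s then f r * F r s j else 0)"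
    using assms[of r] by (cases "r \<in> R") auto
  finally show "block_mult N (block_diag R N s f) F r i j =
      (if r \<in> R \<and> s \<in> N r \<and> i = s then f r * F r s j else 0)"
    by (simp add: block_mult_def mat_mult_def block_diag_def)
qed

lemma block_mult_diag_right:
  assumes "\<And>r. r \<in> R \<Longrightarrow> finite (N r)"
  shows "block_mult N F (block_diag R N s f) =
    (\<lambda>r i j. if r \<in> R \<and> s \<in> N r \<and> j = s then F r i s * f r else 0)"
proof (intro ext)
  fix r i j
  have "(\<Sum>z\<in>N r. F r i z * (if r \<in> R \<and> s \<in> N r \<and> z = s \<and> j = s then f r else 0)) =
        (\<Sum>z\<in>N r. if z = s then (if r \<in> R \<and> s \<in> N r \<and> j = s then F r i s * f r else 0) else 0)"
    by (intro sum.cong) auto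
  also have "\<dots> = (if r \<in> R \<and> s \<in> N r \<and> j = s then F r i s * f r else 0)"
    using assms[of r] by (cases "r \<in> R") auto
  finally show "block_mult N F (block_diag R N s f) r i j =
      (if r \<in> R \<and> s \<in> N r \<and> j = s then F r i s * f r else 0)"
    by (simp add: block_mult_def mat_mult_def block_diag_def)
qed

lemma block_sum_eq_sum_units:
  assumes "finite R" "\<And>r. r \<in> R \<Longrightarrow> finite (N r)" "F \<in> block_sum R N"
  shows "F = (\<Sum>(s, i, j)\<in>Sigma R (\<lambda>s. N s \<times> N s). block_scale (F s i j) (block_unit s i j))"
proof (intro ext)
  fix r k l
  let ?A = "Sigma R (\<lambda>s. N s \<times> N s)"
  have fin: "finite ?A" using assms by auto
  have app: "(\<Sum>a\<in>A. f a) r k l = (\<Sum>a\<in>A. f a r k l)" 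
    for A :: "('a \<times> 'b \<times> 'b) set" and f :: "_ \<Rightarrow> 'a \<Rightarrow> 'b \<Rightarrow> 'b \<Rightarrow> complex"
    by (induction A rule: infinite_finite_induct) auto
  have "(\<Sum>(s, i, j)\<in>?A. block_scale (F s i j) (block_unit s i j)) r k l =
        (\<Sum>a\<in>?A. if a = (r, k, l) then F r k l else 0)"
    unfolding app by (intro sum.cong) (auto simp: block_scale_def block_unit_def mat_scale_def split: if_splits)
  also have "\<dots> = (if (r, k, l) \<in> ?A then F r k l else 0)" using fin by (rule sum.delta)
  also have "\<dots> = F r k l"
    using assms(3) by (cases "r \<in> R") (auto simp: block_sum_def mats_def)
  finally show "F r k l = (\<Sum>(s, i, j)\<in>?A. block_scale (F s i j) (block_unit s i j)) r k l" by simp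
qed

text \<open>
  At its lowest index \<open>s\<close> block \<open>s\<close> is killed by the down-up operator
  \<open>Q = E\<^sub>s A E\<^sub>s\<^sub>-\<^sub>1 A E\<^sub>s\<close>, which acts on every block \<open>r < s\<close> by a nonzero scalar \<open>q r\<close>.
  So \<open>\<Prod>\<^sub>r (Q - q r E\<^sub>s)\<close> isolates block \<open>s\<close>.
\<close>

lemma block_subalgebra_eq_block_sum:
  fixes R :: "nat set" and N :: "nat \<Rightarrow> nat set" and e :: "nat \<Rightarrow> nat"
  assumes R: "finite R" "R \<noteq> {}"
    and N: "\<And>r. r \<in> R \<Longrightarrow> N r = {r..e r}" "\<And>r. r \<in> R \<Longrightarrow> r \<le> e r"
    and C: "block_subalgebra R N C"
    and E: "\<And>r k. r \<in> R \<Longrightarrow> k \<in> N r \<Longrightarrow> block_diag R N k (\<lambda>_. 1) \<in> C"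
    and A: "block_tridiag R N a \<in> C"
    and a: "\<And>r i. r \<in> R \<Longrightarrow> i \<in> N r \<Longrightarrow> Suc i \<in> N r \<Longrightarrow> a r i \<noteq> 0"
  shows "C = block_sum R N"
proof -
  let ?A = "block_tridiag R N a" and ?E = "\<lambda>k. block_diag R N k (\<lambda>_. 1)"
  have fin: "\<And>r. r \<in> R \<Longrightarrow> finite (N r)" using N by simp
  have add: "\<And>F G. F \<in> C \<Longrightarrow> G \<in> C \<Longrightarrow> F + G \<in> C"
    and mult: "\<And>F G. F \<in> C \<Longrightarrow> G \<in> C \<Longrightarrow> block_mult N F G \<in> C"
    and scale: "\<And>c F. F \<in> C \<Longrightarrow> block_scale c F \<in> C" and sub: "C \<subseteq> block_sum R N"
    using C by (auto simp: block_subalgebra_def)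
  have unit_low: "block_unit s s s \<in> C" if s: "s \<in> R" for s
  proof -
    \<comment> \<open>The weight of the round trip from \<open>s\<close> to \<open>s - 1\<close> and
      back in block \<open>r\<close>; the trip is impossible in block \<open>s\<close>, which begins
      at \<open>s\<close>.\<close>
    define q where "q r = (if r < s then a r (s - 1) * a r (s - 1) else 0)" for r
    have Es: "?E s \<in> C" using E[of s s] s N by auto
    have Q: "block_diag R N s q \<in> C"
    \<comment> \<open>If no lower block reaches \<open>s\<close>, nothing guarantees that
      \<open>?E (s - 1)\<close> lies in \<open>C\<close>, and for \<open>s = 0\<close> the
      subtraction is truncated; but then the weighted projection is zero.\<close>
    proof (cases "\<exists>r\<in>R. r < s \<and> s \<in> N r")
      case True
      then obtain r where r: "r \<in> R" "r < s" "s \<in> N r" by blast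
      then have "s - 1 \<in> N r" using N(1)[of r] by auto
      then have E': "?E (s - 1) \<in> C" by (rule E[OF r(1)])
      have "block_mult N (?E s) (block_mult N ?A (block_mult N (?E (s - 1)) (block_mult N ?A (?E s)))) \<in> C"
        by (intro mult Es E' A)
      also have "block_mult N ?A (?E s) = 
         (\<lambda>r i j. if r \<in> R \<and> s \<in> N r \<and> j = s then ?A r i s else 0)"
        by (simp add: block_mult_diag_right fin cong: if_cong)
      also have "block_mult N (?E (s - 1)) \<dots> =
         (\<lambda>r i j. if r \<in> R \<and> r < s \<and> s \<in> N r \<and> i = s - 1 \<and> j = s then a r (s - 1) else 0)"
        using N r by (subst block_mult_diag_left) (auto simp: fin fun_eq_iff block_tridiag_def)
      also have "block_mult N ?A \<dots> =
         (\<lambda>r i j. if r \<in> R \<and> r < s \<and> s \<in> N r \<and> j = s then ?A r i (s - 1) * a r (s - 1) else 0)"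
      proof (intro ext)
        fix r i j
        show "block_mult N ?A (\<lambda>r i j. if r \<in> R \<and> r < s \<and> s \<in> N r \<and> i = s - 1 \<and> j = s
            then a r (s - 1) else 0) r i j =
          (if r \<in> R \<and> r < s \<and> s \<in> N r \<and> j = s then ?A r i (s - 1) * a r (s - 1) else 0)"
        proof (cases "r \<in> R \<and> r < s \<and> s \<in> N r \<and> j = s")
          case True
          then have "s - 1 \<in> N r" "finite (N r)" using N by auto
          moreover have "(\<Sum>z\<in>N r. ?A r i z * (if r \<in> R \<and> r < s \<and> s \<in> N r \<and> z = s - 1 \<and> j = s
            then a r (s - 1) else 0)) = (\<Sum>z\<in>N r. if z = s - 1 then ?A r i (s - 1) * a r (s - 1) else 0)"
            using True by (intro sum.cong) auto
          ultimately show ?thesis using True by (simp add: block_mult_def mat_mult_def)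
        qed (auto simp: block_mult_def mat_mult_def)
      qed
      also have "block_mult N (?E s) \<dots> = block_diag R N s q"
        using N r by (subst block_mult_diag_left)
          (auto simp: fin fun_eq_iff block_tridiag_def block_diag_def q_def)
      finally show ?thesis .
    next
      case False
      then have "block_diag R N s q = block_scale 0 (?E s)"
        by (auto simp: fun_eq_iff block_diag_def block_scale_def mat_scale_def q_def)
      then show ?thesis using scale Es by simp
    qed
    have prod: "block_diag R N s (\<lambda>r. \<Prod>r'\<in>M. q r - q r') \<in> C" if "finite M" for M
      using that
    proof (induction M)
      case empty
      then show ?case using Es by simp
    next
      case (insert m M)
      have "block_mult N (block_diag R N s q + block_scale (- q m) (?E s))
              (block_diag R N s (\<lambda>r. \<Prod>r'\<in>M. q r - q r')) \<in> C"
        by (intro mult add scale Q Es insert.IH)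
      also have "block_mult N (block_diag R N s q + block_scale (- q m) (?E s))
              (block_diag R N s (\<lambda>r. \<Prod>r'\<in>M. q r - q r')) =
            block_diag R N s (\<lambda>r. \<Prod>r'\<in>insert m M. q r - q r')"
        using insert.hyps by (subst block_mult_diag_right)
          (auto simp: fin fun_eq_iff block_diag_def block_scale_def mat_scale_def)
      finally show ?case .
    qed
    let ?M = "{r \<in> R. r < s \<and> s \<in> N r}"
    let ?c = "\<Prod>r'\<in>?M. q s - q r'"
    have finM: "finite ?M" using R by auto
    \<comment> \<open>As \<open>q s = 0\<close>, each factor is minus the square of a nonzero
      tridiagonal entry.\<close>
    have "?c \<noteq> 0"
    proof -
      have "q s - q r' \<noteq> 0" if r': "r' \<in> ?M" for r'
      proof -
        have "s - 1 \<in> N r'" "Suc (s - 1) \<in> N r'" using r' N(1)[of r'] by auto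
        then have "a r' (s - 1) \<noteq> 0" using a r' by blast
        then show ?thesis using r' by (simp add: q_def)
      qed
      then show ?thesis using finM by (simp add: prod_zero_iff)
    qed
    moreover have "(\<Prod>r'\<in>?M. q r - q r') = 0" if "r \<in> R" "s \<in> N r" "r \<noteq> s" for r
    proof -
      have "r \<in> ?M" using that N by auto
      then show ?thesis using finM by (auto simp: prod_zero_iff)
    qed
    ultimately have "block_unit s s s = block_scale (1 / ?c) (block_diag R N s (\<lambda>r. \<Prod>r'\<in>?M. q r - q r'))"
      using s N by (auto simp: fun_eq_iff block_diag_def block_scale_def mat_scale_def block_unit_def)
    then show ?thesis using scale prod[OF finM] by simp
  qed
  \<comment> \<open>The first column of block \<open>s\<close> is climbed from its corner:
    \<open>?A\<close> moves the row index to its neighbours and \<open>?E (Suc i)\<close> keeps the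
    upper one.\<close>
  have unit_col: "block_unit s i s \<in> C" if s: "s \<in> R" and i: "s \<le> i" "i \<le> e s" for s i
    using i
  proof (induction i rule: dec_induct)
    case base
    then show ?case using unit_low s by simp
  next
    case (step i)
    have iN: "i \<in> N s" "Suc i \<in> N s" "s \<in> N s" using step N[OF s] by auto
    have "block_mult N (?E (Suc i)) (block_mult N ?A (block_unit s i s)) \<in> C"
      using step iN by (intro mult A E[OF s]) auto
    also have "block_mult N (?E (Suc i)) (block_mult N ?A (block_unit s i s)) =
        block_scale (a s i) (block_unit s (Suc i) s)"
      using s iN fin by (simp add: block_mult_unit_right)
        (auto simp: block_mult_diag_left fun_eq_iff block_tridiag_def block_scale_def mat_scale_def block_unit_def)
    finally have "block_scale (1 / a s i) (block_scale (a s i) (block_unit s (Suc i) s)) \<in> C"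
      by (rule scale)
    then show ?case using a[OF s iN(1,2)]
      by (simp add: block_scale_def mat_scale_def)
  qed
  have unit_row: "block_unit s s i \<in> C" if s: "s \<in> R" and i: "s \<le> i" "i \<le> e s" for s i
    using i
  proof (induction i rule: dec_induct)
    case base
    then show ?case using unit_low s by simp
  next
    case (step i)
    have iN: "i \<in> N s" "Suc i \<in> N s" "s \<in> N s" using step N[OF s] by auto
    have "block_mult N (block_mult N (block_unit s s i) ?A) (?E (Suc i)) \<in> C"
      using step iN by (intro mult A E[OF s]) auto
    also have "block_mult N (block_mult N (block_unit s s i) ?A) (?E (Suc i)) =
        block_scale (a s i) (block_unit s s (Suc i))"
      using s iN fin by (simp add: block_mult_unit_left)
        (auto simp: block_mult_diag_right fun_eq_iff block_tridiag_def block_scale_def mat_scale_def block_unit_def)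
    finally have "block_scale (1 / a s i) (block_scale (a s i) (block_unit s s (Suc i))) \<in> C"
      by (rule scale)
    then show ?case using a[OF s iN(1,2)]
      by (simp add: block_scale_def mat_scale_def)
  qed
  have unit: "block_unit s i j \<in> C" if s: "s \<in> R" and ij: "i \<in> N s" "j \<in> N s" for s i j
  proof -
    have sN: "s \<in> N s" using N[OF s] by auto
    have "block_mult N (block_unit s i s) (block_unit s s j) \<in> C"
      using ij N[OF s] by (intro mult unit_col unit_row s) auto
    also have "block_mult N (block_unit s i s) (block_unit s s j) = block_unit s i j"
      using sN fin[OF s] by (simp add: block_mult_unit_left) (auto simp: block_unit_def fun_eq_iff)
    finally show ?thesis .
  qed
  have "F \<in> C" if F: "F \<in> block_sum R N" for F
  proof -
    have "(\<Sum>x\<in>Sigma R (\<lambda>s. N s \<times> N s). (case x of (s, i, j) \<Rightarrow> block_scale (F s i j) (block_unit s i j))) \<in> C"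
    proof (rule block_subalgebra_sum[OF C])
      show "finite (Sigma R (\<lambda>s. N s \<times> N s))" using R fin by auto
      obtain r where "r \<in> R" using R by auto
      then have "(r, r, r) \<in> Sigma R (\<lambda>s. N s \<times> N s)" using N[of r] by auto
      then show "Sigma R (\<lambda>s. N s \<times> N s) \<noteq> {}" by blast
    qed (auto intro!: scale unit)
    then show ?thesis using block_sum_eq_sum_units[OF R(1) fin F] by simp
  qed
  then show ?thesis using sub by auto
qed

section \<open>Orthonormal bases adapted to a matrix algebra\<close>

lemma sum_fun_apply: "(\<Sum>a\<in>A. f a) x = (\<Sum>a\<in>A. f a x)"
  by (induction A rule: infinite_finite_induct) auto

lemma cinner_diff_left: "cinner X (v - v') w = cinner X v w - cinner X v' w"
  by (simp add: cinner_def algebra_simps sum_subtractf)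

lemma cinner_sum_left: "cinner X (\<Sum>a\<in>A. (\<lambda>x. c a * v a x)) w = (\<Sum>a\<in>A. c a * cinner X (v a) w)"
proof -
  have "cinner X (\<Sum>a\<in>A. (\<lambda>x. c a * v a x)) w = (\<Sum>x\<in>X. \<Sum>a\<in>A. c a * (v a x * cnj (w x)))"
    by (simp add: cinner_def sum_fun_apply sum_distrib_right mult.assoc)
  also have "\<dots> = (\<Sum>a\<in>A. \<Sum>x\<in>X. c a * (v a x * cnj (w x)))" by (rule sum.swap)
  finally show ?thesis by (simp add: cinner_def sum_distrib_left)
qed

lemma cinner_cnj: "cnj (cinner X v w) = cinner X w v"
  by (simp add: cinner_def mult.commute)

lemma cinner_self_eq_0:
  assumes "finite X" "v \<in> vecs X" "cinner X v v = 0"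
  shows "v = 0"
proof -
  have "cinner X v v = complex_of_real (\<Sum>x\<in>X. (cmod (v x))\<^sup>2)"
    by (simp add: cinner_def complex_norm_square[symmetric])
  then have "(\<Sum>x\<in>X. (cmod (v x))\<^sup>2) = 0" using assms(3) by (metis of_real_eq_0_iff)
  then have "\<forall>x\<in>X. v x = 0" using assms(1) by (simp add: sum_nonneg_eq_0_iff)
  then show ?thesis using assms(2) by (auto simp: vecs_def fun_eq_iff)
qed

lemma subspace_vecs: "cfun.subspace (vecs X)"
  by (auto simp: cfun.subspace_def vecs_def)

lemma orthonormal_imp_independent:
  assumes "\<And>v w. v \<in> Q \<Longrightarrow> w \<in> Q \<Longrightarrow> cinner X v w = (if v = w then 1 else 0)"
  shows "\<not> cdependent Q"
proof
  assume "cdependent Q"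
  then obtain t c v where t: "finite t" "t \<subseteq> Q" "(\<Sum>v\<in>t. (\<lambda>x. c v * v x)) = 0" "v \<in> t" "c v \<noteq> 0"
    unfolding cfun.dependent_explicit by blast
  have "0 = cinner X (\<Sum>v\<in>t. (\<lambda>x. c v * v x)) v" by (simp add: t cinner_def)
  also have "\<dots> = (\<Sum>w\<in>t. c w * cinner X w v)" by (rule cinner_sum_left)
  also have "\<dots> = (\<Sum>w\<in>t. if w = v then c w else 0)"
  proof (intro sum.cong refl)
    fix w assume "w \<in> t"
    then have "cinner X w v = (if w = v then 1 else 0)" using t assms by blast
    then show "c w * cinner X w v = (if w = v then c w else 0)" by simp
  qed
  also have "\<dots> = c v" using t by simp
  finally show False using t by simp
qed

lemma vecs_eq_span_deltas:
  assumes "finite X"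
  shows "vecs X = cspan ((\<lambda>a x. if x = a then 1 else 0) ` X)"
proof
  show "cspan ((\<lambda>a x. if x = a then 1 else 0) ` X) \<subseteq> vecs X"
    by (rule cfun.span_minimal[OF _ subspace_vecs]) (auto simp: vecs_def)
  show "vecs X \<subseteq> cspan ((\<lambda>a x. if x = a then 1 else 0) ` X)"
  proof
    fix v :: "'a \<Rightarrow> complex" assume v: "v \<in> vecs X"
    have "v = (\<Sum>a\<in>X. (\<lambda>x. v a * (if x = a then 1 else 0)))"
    proof
      fix x
      have "(\<Sum>a\<in>X. v a * (if x = a then 1 else 0)) = (\<Sum>a\<in>X. if a = x then v x else 0)"
        by (intro sum.cong) auto
      also have "\<dots> = v x" using v assms by (simp add: vecs_def)
      finally show "v x = (\<Sum>a\<in>X. (\<lambda>x. v a * (if x = a then 1 else 0))) x"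
        by (simp add: sum_fun_apply)
    qed
    also have "\<dots> \<in> cspan ((\<lambda>a x. if x = a then 1 else 0) ` X)"
      by (intro cfun.span_sum cfun.span_scale cfun.span_base imageI)
    finally show "v \<in> cspan ((\<lambda>a x. if x = a then 1 else 0) ` X)" .
  qed
qed

lemma independent_vecs_finite:
  assumes "finite X" "Q \<subseteq> vecs X" "\<not> cdependent Q"
  shows "finite Q"
  using cfun.independent_span_bound[of "(\<lambda>a x. if x = a then 1 else 0) ` X" Q] assms
  by (simp add: vecs_eq_span_deltas)

text \<open>Subtracting from \<open>f\<close> its expansion in \<open>Q\<close> leaves a vector
  orthogonal to \<open>Q\<close>, so a trivial orthogonal complement yields spanning. The expansion
  is a finite sum because \<open>Q\<close> is independent.\<close>

lemma orthonormal_basis_vecsI: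
  assumes X: "finite X" and Q: "Q \<subseteq> vecs X"
    and orth: "\<And>v w. v \<in> Q \<Longrightarrow> w \<in> Q \<Longrightarrow> cinner X v w = (if v = w then 1 else 0)"
    and complete: "\<And>f. f \<in> vecs X \<Longrightarrow> (\<And>v. v \<in> Q \<Longrightarrow> cinner X f v = 0) \<Longrightarrow> f = 0"
  shows "orthonormal_basis X (vecs X) Q"
proof -
  have indep: "\<not> cdependent Q" using orthonormal_imp_independent orth by blast
  have fin: "finite Q" using independent_vecs_finite[OF X Q indep] .
  have "vecs X \<subseteq> cspan Q"
  proof
    fix f assume f: "f \<in> vecs X"
    let ?g = "\<Sum>v\<in>Q. (\<lambda>x. cinner X f v * v x)"
    have g: "?g \<in> cspan Q"
      by (intro cfun.span_sum cfun.span_scale cfun.span_base)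
    moreover have "cspan Q \<subseteq> vecs X" by (rule cfun.span_minimal[OF Q subspace_vecs])
    ultimately have "f - ?g \<in> vecs X"
      using f cfun.subspace_diff[OF subspace_vecs] by blast
    moreover have "cinner X (f - ?g) v = 0" if v: "v \<in> Q" for v
    proof -
      have "cinner X ?g v = (\<Sum>w\<in>Q. cinner X f w * cinner X w v)" by (rule cinner_sum_left)
      also have "\<dots> = (\<Sum>w\<in>Q. if w = v then cinner X f w else 0)"
      proof (intro sum.cong refl)
        fix w assume "w \<in> Q"
        then have "cinner X w v = (if w = v then 1 else 0)" using v orth by blast
        then show "cinner X f w * cinner X w v = (if w = v then cinner X f w else 0)" by simp
      qed
      also have "\<dots> = cinner X f v" using v fin by simp
      finally show ?thesis by (simp only: cinner_diff_left) simp
    qed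
    ultimately have "f - ?g = 0" by (rule complete)
    then have "f = ?g" by (simp only: right_minus_eq)
    then show "f \<in> cspan Q" using g by simp
  qed
  moreover have "cspan Q \<subseteq> vecs X" by (rule cfun.span_minimal[OF Q subspace_vecs])
  ultimately show ?thesis using indep orth by (auto simp: orthonormal_basis_def)
qed

section \<open>Matrices acting on vectors, and generated algebras\<close>

lemma mat_vec_mult: "mat_vec X (mat_mult X M M') v = mat_vec X M (mat_vec X M' v)"
proof
  fix x
  have "mat_vec X (mat_mult X M M') v x = (\<Sum>y\<in>X. \<Sum>z\<in>X. M x z * M' z y * v y)"
    by (simp add: mat_vec_def mat_mult_def sum_distrib_right)
  also have "\<dots> = (\<Sum>z\<in>X. \<Sum>y\<in>X. M x z * M' z y * v y)" by (rule sum.swap)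
  finally show "mat_vec X (mat_mult X M M') v x = mat_vec X M (mat_vec X M' v) x"
    by (simp add: mat_vec_def sum_distrib_left mult.assoc)
qed

lemma mat_vec_add: "mat_vec X (M + M') v = mat_vec X M v + mat_vec X M' v"
  by (simp add: mat_vec_def fun_eq_iff distrib_right sum.distrib)

lemma mat_vec_scale: "mat_vec X (mat_scale c M) v = (\<lambda>x. c * mat_vec X M v x)"
  by (simp add: mat_vec_def mat_scale_def fun_eq_iff sum_distrib_left mult.assoc)

lemma mat_vec_one: "finite X \<Longrightarrow> v \<in> vecs X \<Longrightarrow> mat_vec X (mat_one X) v = v"
proof
  fix x assume a: "finite X" "v \<in> vecs X"
  have "(\<Sum>y\<in>X. (if x \<in> X \<and> x = y then 1 else 0) * v y) = (\<Sum>y\<in>X. if x = y then v y else 0)"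
    by (intro sum.cong) auto
  then show "mat_vec X (mat_one X) v x = v x"
    using a by (auto simp: mat_vec_def mat_one_def vecs_def)
qed

lemma mat_vec_lincomb:
  "mat_vec X M (\<lambda>x. \<Sum>a\<in>A. c a * v a x) = (\<lambda>x. \<Sum>a\<in>A. c a * mat_vec X M (v a) x)"
proof
  fix x
  have "mat_vec X M (\<lambda>x. \<Sum>a\<in>A. c a * v a x) x = (\<Sum>y\<in>X. \<Sum>a\<in>A. c a * (M x y * v a y))"
    by (simp add: mat_vec_def sum_distrib_left mult.left_commute)
  also have "\<dots> = (\<Sum>a\<in>A. \<Sum>y\<in>X. c a * (M x y * v a y))" by (rule sum.swap)
  finally show "mat_vec X M (\<lambda>x. \<Sum>a\<in>A. c a * v a x) x = (\<Sum>a\<in>A. c a * mat_vec X M (v a) x)"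
    by (simp add: mat_vec_def sum_distrib_left)
qed

text \<open>\<open>mats X\<close> is itself a subalgebra containing \<open>G\<close>, so the
  defining intersection is over a nonempty family and stays inside \<open>mats X\<close>.\<close>

lemma mat_subalgebra_generated:
  assumes "G \<subseteq> mats X"
  shows "mat_subalgebra X (generated_algebra X G)"
proof -
  have full: "mat_subalgebra X (mats X)"
    by (auto simp: mat_subalgebra_def mats_def mat_one_def mat_mult_def mat_scale_def)
  have "generated_algebra X G \<subseteq> mats X" using full assms by (auto simp: generated_algebra_def)
  then show ?thesis
    unfolding mat_subalgebra_def generated_algebra_def by blast
qed

lemma generated_algebra_superset: "G \<subseteq> generated_algebra X G"
  by (auto simp: generated_algebra_def)

lemma generated_algebra_least:
  "mat_subalgebra X A \<Longrightarrow> G \<subseteq> A \<Longrightarrow> generated_algebra X G \<subseteq> A"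
  by (auto simp: generated_algebra_def)

text \<open>
  An orthonormal basis of real vectors \<open>u r \<xi> i\<close> of \<open>\<complex>\<^sup>X\<close>, thought of as a decomposition into
  subspaces indexed by \<open>(r, \<xi>)\<close>; subspaces with the same \<open>r\<close> are to be isomorphic modules.
\<close>

locale adapted_basis =
  fixes X :: "'a set" and R :: "'r set" and B :: "'r \<Rightarrow> 'k set" and N :: "'r \<Rightarrow> 'i set"
    and u :: "'r \<Rightarrow> 'k \<Rightarrow> 'i \<Rightarrow> 'a \<Rightarrow> complex"
  assumes finX: "finite X" and finN: "\<And>r. r \<in> R \<Longrightarrow> finite (N r)"
    and B_nonempty: "\<And>r. r \<in> R \<Longrightarrow> B r \<noteq> {}"
    and u_vecs: "\<And>r \<xi> i. r \<in> R \<Longrightarrow> \<xi> \<in> B r \<Longrightarrow> i \<in> N r \<Longrightarrow> u r \<xi> i \<in> vecs X"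
    and u_real: "\<And>r \<xi> i x. r \<in> R \<Longrightarrow> \<xi> \<in> B r \<Longrightarrow> i \<in> N r \<Longrightarrow> u r \<xi> i x \<in> \<real>"
    and u_orth: "\<And>r \<xi> i s \<eta> j. \<lbrakk>r \<in> R; \<xi> \<in> B r; i \<in> N r; s \<in> R; \<eta> \<in> B s; j \<in> N s\<rbrakk> \<Longrightarrow>
       cinner X (u r \<xi> i) (u s \<eta> j) = (if (r, \<xi>, i) = (s, \<eta>, j) then 1 else 0)"
    and complete: "\<And>f. f \<in> vecs X \<Longrightarrow>
       (\<And>r \<xi> i. r \<in> R \<Longrightarrow> \<xi> \<in> B r \<Longrightarrow> i \<in> N r \<Longrightarrow> cinner X f (u r \<xi> i) = 0) \<Longrightarrow> f = 0"
begin

definition idx :: "('r \<times> 'k \<times> 'i) set" where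
  "idx = {(r, \<xi>, i). r \<in> R \<and> \<xi> \<in> B r \<and> i \<in> N r}"

definition U :: "'a \<Rightarrow> 'r \<times> 'k \<times> 'i \<Rightarrow> complex" where
  "U = (\<lambda>x (r, \<xi>, i). u r \<xi> i x)"

lemma U_orth: "b \<in> idx \<Longrightarrow> b' \<in> idx \<Longrightarrow> cinner X (\<lambda>x. U x b) (\<lambda>x. U x b') = (if b = b' then 1 else 0)"
  unfolding idx_def U_def by clarify (simp add: u_orth)

lemma inj_U: "inj_on (\<lambda>b x. U x b) idx"
  by (rule inj_onI) (metis U_orth zero_neq_one)

lemma orthonormal_basis_U: "orthonormal_basis X (vecs X) ((\<lambda>b x. U x b) ` idx)"
proof (rule orthonormal_basis_vecsI[OF finX])
  show "(\<lambda>b x. U x b) ` idx \<subseteq> vecs X" using u_vecs by (auto simp: idx_def U_def)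
  show "cinner X v w = (if v = w then 1 else 0)"
    if "v \<in> (\<lambda>b x. U x b) ` idx" "w \<in> (\<lambda>b x. U x b) ` idx" for v w
    using that U_orth inj_U by (auto simp: inj_on_def)
  show "f = 0" if f: "f \<in> vecs X" "\<And>v. v \<in> (\<lambda>b x. U x b) ` idx \<Longrightarrow> cinner X f v = 0" for f
  proof (rule complete[OF f(1)])
    fix r \<xi> i assume "r \<in> R" "\<xi> \<in> B r" "i \<in> N r"
    then have "(\<lambda>x. U x (r, \<xi>, i)) \<in> (\<lambda>b x. U x b) ` idx" by (auto simp: idx_def)
    from f(2)[OF this] show "cinner X f (u r \<xi> i) = 0" by (simp add: U_def)
  qed
qed

text \<open>\<open>C r\<close> is the matrix of \<open>M\<close> on the span of the
  \<open>u r \<xi> i\<close> for fixed \<open>r\<close> and \<xi>, and it is the same for all \<xi>.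
  As a relation this passes through the algebra operations without a choice of \<open>C\<close>; the
  vanishing outside the index sets lets \<open>M\<close> and \<open>C\<close> determine each
  other.\<close>

definition rep :: "('a \<Rightarrow> 'a \<Rightarrow> complex) \<Rightarrow> ('r \<Rightarrow> 'i \<Rightarrow> 'i \<Rightarrow> complex) \<Rightarrow> bool" where
  "rep M C \<longleftrightarrow> M \<in> mats X \<and> C \<in> block_sum R N \<and>
     (\<forall>r\<in>R. \<forall>\<xi>\<in>B r. \<forall>j\<in>N r. mat_vec X M (u r \<xi> j) = (\<lambda>x. \<Sum>i\<in>N r. C r i j * u r \<xi> i x))"

text \<open>The columns are real, so the transpose acts as the adjoint and the entry is an inner
  product with \<open>u r \<xi> i\<close>.\<close>

lemma rep_entry:
  assumes M: "rep M C" and b: "(r, \<xi>, i) \<in> idx" "(s, \<eta>, j) \<in> idx"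
  shows "mat_mult X (mat_mult X (mat_transpose U) M) U (r, \<xi>, i) (s, \<eta>, j) =
         (if (r, \<xi>) = (s, \<eta>) then C r i j else 0)"
proof -
  have b': "r \<in> R" "\<xi> \<in> B r" "i \<in> N r" "s \<in> R" "\<eta> \<in> B s" "j \<in> N s" using b by (auto simp: idx_def)
  have "mat_mult X (mat_mult X (mat_transpose U) M) U (r, \<xi>, i) (s, \<eta>, j) =
        (\<Sum>y\<in>X. \<Sum>x\<in>X. u r \<xi> i x * M x y * u s \<eta> j y)"
    by (simp add: mat_mult_def mat_transpose_def U_def sum_distrib_right)
  also have "\<dots> = (\<Sum>x\<in>X. \<Sum>y\<in>X. u r \<xi> i x * M x y * u s \<eta> j y)" by (rule sum.swap)
  also have "\<dots> = (\<Sum>x\<in>X. mat_vec X M (u s \<eta> j) x * u r \<xi> i x)"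
    by (simp add: mat_vec_def sum_distrib_right sum_distrib_left ac_simps)
  also have "\<dots> = (\<Sum>x\<in>X. mat_vec X M (u s \<eta> j) x * cnj (u r \<xi> i x))"
    using u_real[OF b'(1-3)] by (simp add: Reals_cnj_iff)
  also have "\<dots> = cinner X (\<Sum>k\<in>N s. (\<lambda>x. C s k j * u s \<eta> k x)) (u r \<xi> i)"
    using M b' by (simp add: rep_def cinner_def sum_fun_apply)
  also have "\<dots> = (\<Sum>k\<in>N s. C s k j * cinner X (u s \<eta> k) (u r \<xi> i))" by (rule cinner_sum_left)
  also have "\<dots> = (\<Sum>k\<in>N s. if k = i then (if (r, \<xi>) = (s, \<eta>) then C s k j else 0) else 0)"
    using b' by (intro sum.cong) (auto simp: u_orth)
  also have "\<dots> = (if (r, \<xi>) = (s, \<eta>) then C r i j else 0)"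
    using b' finN[of s] by auto
  finally show ?thesis .
qed

text \<open>Since \<open>B r\<close> is nonempty, every entry of block \<open>r\<close> can be read
  off from the conjugated matrix.\<close>

lemma rep_unique:
  assumes "rep M C" "rep M C'"
  shows "C = C'"
proof (intro ext)
  fix r i j
  show "C r i j = C' r i j"
  proof (cases "r \<in> R \<and> i \<in> N r \<and> j \<in> N r")
    case True
    then obtain \<xi> where "\<xi> \<in> B r" using B_nonempty by blast
    then have "(r, \<xi>, i) \<in> idx" "(r, \<xi>, j) \<in> idx" using True by (auto simp: idx_def)
    from rep_entry[OF assms(1) this] rep_entry[OF assms(2) this] show ?thesis by simp
  next
    case False
    have "C \<in> block_sum R N" "C' \<in> block_sum R N" using assms by (auto simp: rep_def)
    then show ?thesis using False by (cases "r \<in> R") (auto simp: block_sum_def mats_def)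
  qed
qed

text \<open>Each row of \<open>M - M'\<close> is orthogonal to all basis vectors, again because
  these are real, and vanishes by completeness.\<close>

lemma rep_inj:
  assumes "rep M C" "rep M' C"
  shows "M = M'"
proof -
  have MX: "M \<in> mats X" "M' \<in> mats X" using assms by (auto simp: rep_def)
  have "(\<lambda>y. M x y - M' x y) = 0" for x
  proof (rule complete)
    show "(\<lambda>y. M x y - M' x y) \<in> vecs X" using MX by (auto simp: vecs_def mats_def)
    fix r \<xi> i assume a: "r \<in> R" "\<xi> \<in> B r" "i \<in> N r"
    have "cinner X (\<lambda>y. M x y - M' x y) (u r \<xi> i) = (\<Sum>y\<in>X. (M x y - M' x y) * u r \<xi> i y)"
      using u_real[OF a] by (simp add: cinner_def Reals_cnj_iff)
    also have "\<dots> = mat_vec X M (u r \<xi> i) x - mat_vec X M' (u r \<xi> i) x"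
      by (simp add: mat_vec_def sum_subtractf algebra_simps)
    also have "\<dots> = 0" using assms a by (simp add: rep_def)
    finally show "cinner X (\<lambda>y. M x y - M' x y) (u r \<xi> i) = 0" .
  qed
  then show ?thesis by (auto simp: fun_eq_iff)
qed

lemma rep_add: "rep M C \<Longrightarrow> rep M' C' \<Longrightarrow> rep (M + M') (C + C')"
  by (auto simp: rep_def mats_def block_sum_def mat_vec_add fun_eq_iff distrib_right sum.distrib)

lemma rep_scale: "rep M C \<Longrightarrow> rep (mat_scale c M) (block_scale c C)"
  unfolding rep_def mat_vec_scale
  by (auto simp: mats_def block_sum_def block_scale_def fun_eq_iff
      mat_scale_def sum_distrib_left mult.assoc)

lemma rep_one: "rep (mat_one X) (block_one R N)"
proof -
  have "(\<lambda>x. \<Sum>i\<in>N r. block_one R N r i j * u r \<xi> i x) = u r \<xi> j"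
    if "r \<in> R" "j \<in> N r" for r \<xi> j
  proof
    fix x
    have "(\<Sum>i\<in>N r. block_one R N r i j * u r \<xi> i x) = (\<Sum>i\<in>N r. if i = j then u r \<xi> i x else 0)"
      using that by (intro sum.cong) (auto simp: block_one_def mat_one_def)
    then show "(\<Sum>i\<in>N r. block_one R N r i j * u r \<xi> i x) = u r \<xi> j x"
      using that finN by simp
  qed
  moreover have "block_one R N \<in> block_sum R N"
    by (auto simp: block_sum_def block_one_def mats_def mat_one_def)
  moreover have "mat_one X \<in> mats X" by (auto simp: mats_def mat_one_def)
  ultimately show ?thesis by (auto simp: rep_def mat_vec_one finX u_vecs)
qed

lemma rep_mult:
  assumes "rep M C" "rep M' C'"
  shows "rep (mat_mult X M M') (block_mult N C C')"
proof -
  have "mat_vec X (mat_mult X M M') (u r \<xi> j) = (\<lambda>x. \<Sum>i\<in>N r. block_mult N C C' r i j * u r \<xi> i x)"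
    if a: "r \<in> R" "\<xi> \<in> B r" "j \<in> N r" for r \<xi> j
  proof
    fix x
    have "mat_vec X (mat_mult X M M') (u r \<xi> j) x = mat_vec X M (\<lambda>x. \<Sum>k\<in>N r. C' r k j * u r \<xi> k x) x"
      using assms(2) a by (simp add: mat_vec_mult rep_def)
    also have "\<dots> = (\<Sum>k\<in>N r. C' r k j * (\<Sum>i\<in>N r. C r i k * u r \<xi> i x))"
      using assms(1) a by (simp add: mat_vec_lincomb rep_def)
    also have "\<dots> = (\<Sum>k\<in>N r. \<Sum>i\<in>N r. C r i k * C' r k j * u r \<xi> i x)"
      by (simp add: sum_distrib_left ac_simps)
    also have "\<dots> = (\<Sum>i\<in>N r. \<Sum>k\<in>N r. C r i k * C' r k j * u r \<xi> i x)" by (rule sum.swap)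
    finally show "mat_vec X (mat_mult X M M') (u r \<xi> j) x = (\<Sum>i\<in>N r. block_mult N C C' r i j * u r \<xi> i x)"
      by (simp add: block_mult_def mat_mult_def sum_distrib_right)
  qed
  moreover have "block_mult N C C' \<in> block_sum R N" "mat_mult X M M' \<in> mats X"
    using assms by (auto simp: rep_def block_sum_def block_mult_def mats_def mat_mult_def fun_eq_iff)
  ultimately show ?thesis by (auto simp: rep_def)
qed

text \<open>By minimality of the generated algebra it then suffices to represent generators.\<close>

lemma mat_subalgebra_rep: "mat_subalgebra X {M. \<exists>C. rep M C}"
proof -
  have "{M. \<exists>C. rep M C} \<subseteq> mats X" by (auto simp: rep_def)
  then show ?thesis
    unfolding mat_subalgebra_def using rep_add rep_mult rep_one rep_scale by blast
qed

lemma isomorphic_to_block_sum_of_rep: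
  assumes T: "mat_subalgebra X T" "\<And>M. M \<in> T \<Longrightarrow> \<exists>C. rep M C"
    and surj: "{C. \<exists>M\<in>T. rep M C} = block_sum R N"
  shows "isomorphic_to_block_sum X T R N"
proof -
  define \<phi> where "\<phi> M = (THE C. rep M C)" for M
  have phi_eq: "\<phi> M = C" if "rep M C" for M C
    unfolding \<phi>_def using that rep_unique by blast
  have phi: "rep M (\<phi> M)" if M: "M \<in> T" for M
    using T(2)[OF M] phi_eq by auto
  have "inj_on \<phi> T"
    by (rule inj_onI) (metis phi rep_inj)
  moreover have "\<phi> ` T = block_sum R N"
  proof -
    have "\<phi> ` T = {C. \<exists>M\<in>T. rep M C}" using phi phi_eq by force
    then show ?thesis using surj by simp
  qed
  moreover have "\<phi> (M + M') = \<phi> M + \<phi> M'" if "M \<in> T" "M' \<in> T" for M M'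
    using that by (intro phi_eq rep_add phi)
  moreover have "\<phi> (mat_scale c M) = (\<lambda>r. mat_scale c (\<phi> M r))" if "M \<in> T" for M c
    using phi_eq[OF rep_scale[OF phi[OF that]]] by (simp add: block_scale_def)
  moreover have "\<phi> (mat_mult X M M') = block_mult N (\<phi> M) (\<phi> M')" if "M \<in> T" "M' \<in> T" for M M'
    using that by (intro phi_eq rep_mult phi)
  moreover have "\<phi> (mat_one X) = block_one R N" by (rule phi_eq[OF rep_one])
  ultimately show ?thesis
    unfolding isomorphic_to_block_sum_def bij_betw_def by blast
qed

lemma block_subalgebra_rep_image:
  assumes "mat_subalgebra X T"
  shows "block_subalgebra R N {C. \<exists>M\<in>T. rep M C}"
proof -
  have "\<exists>M\<in>T. rep M (C + C')" "\<exists>M\<in>T. rep M (block_mult N C C')"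
    if "M \<in> T" "rep M C" "M' \<in> T" "rep M' C'" for M M' C C'
    using that assms rep_add rep_mult unfolding mat_subalgebra_def by blast+
  moreover have "\<exists>M\<in>T. rep M (block_scale c C)" if "M \<in> T" "rep M C" for M C c
    using that assms rep_scale unfolding mat_subalgebra_def by blast
  moreover have "C \<in> block_sum R N" if "rep M C" for M C using that by (simp add: rep_def)
  ultimately show ?thesis unfolding block_subalgebra_def by blast
qed

end

section \<open>The folded cube\<close>

text \<open>Symmetric difference with \<open>{z}\<close>: a step along an edge of the unfolded
  cube.\<close>

definition toggle :: "'a \<Rightarrow> 'a set \<Rightarrow> 'a set" where
  "toggle z w = (if z \<in> w then w - {z} else insert z w)"

locale folded_cube =
  fixes D :: nat and p :: "vertex \<Rightarrow> nat set \<times> nat set"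
  assumes D_ge_3: "3 \<le> D" and lab: "fc_labelling D p"
begin

abbreviation "S \<equiv> ground D"
abbreviation "X \<equiv> fc_verts D"

text \<open>A vertex named by either of its halves. The map is two-to-one and independent of the
  labelling, so computations can take place on subsets of \<open>S\<close>.\<close>

definition vert :: "nat set \<Rightarrow> vertex" where
  "vert w = {w, S - w}"

definition level :: "vertex \<Rightarrow> nat" where
  "level x = card (fst (p x))"

lemma finite_S [simp]: "finite S" and card_S [simp]: "card S = 2 * D"
  by (auto simp: ground_def)

lemma finite_sub: "w \<subseteq> S \<Longrightarrow> finite w"
  using finite_S finite_subset by blast

lemma card_compl: "w \<subseteq> S \<Longrightarrow> card (S - w) = 2 * D - card w"
  by (simp add: card_Diff_subset finite_sub)

lemma verts_eq: "X = vert ` Pow S"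
proof -
  have "u \<inter> u' = {} \<and> u \<union> u' = S \<longleftrightarrow> u \<subseteq> S \<and> u' = S - u" for u u' by auto
  then show ?thesis by (auto simp: fc_verts_def vert_def)
qed

lemma finite_X [simp]: "finite X"
  by (simp add: verts_eq)

lemma vert_in_X [simp]: "w \<subseteq> S \<Longrightarrow> vert w \<in> X"
  by (auto simp: verts_eq)

lemma vert_compl: "w \<subseteq> S \<Longrightarrow> vert (S - w) = vert w"
  by (auto simp: vert_def double_diff)

lemma vert_eq_iff: "w \<subseteq> S \<Longrightarrow> w' \<subseteq> S \<Longrightarrow> vert w = vert w' \<longleftrightarrow> w' = w \<or> w' = S - w"
  by (auto simp: vert_def doubleton_eq_iff double_diff)

lemma p_vert:
  assumes "w \<subseteq> S"
  shows "p (vert w) = (w, S - w) \<or> p (vert w) = (S - w, w)"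
proof -
  have "vert w = {fst (p (vert w)), snd (p (vert w))}"
    using lab assms unfolding fc_labelling_def by simp
  then have "(w = fst (p (vert w)) \<and> S - w = snd (p (vert w))) \<or> 
      (w = snd (p (vert w)) \<and> S - w = fst (p (vert w)))"
    unfolding vert_def by (subst (asm) doubleton_eq_iff) blast
  then show ?thesis by (metis prod.collapse)
qed

lemma p_vert_card: "w \<subseteq> S \<Longrightarrow> card (fst (p (vert w))) \<le> card (snd (p (vert w)))"
  using lab unfolding fc_labelling_def by simp

lemma p_vert_less:
  assumes "w \<subseteq> S" "card w < D"
  shows "p (vert w) = (w, S - w)"
  using p_vert[OF assms(1)] p_vert_card[OF assms(1)] assms card_compl[OF assms(1)] by auto

lemma level_vert:
  assumes "w \<subseteq> S" "card w \<le> D"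
  shows "level (vert w) = card w"
  using p_vert[OF assms(1)] p_vert_card[OF assms(1)] assms card_compl[OF assms(1)]
  by (auto simp: level_def)

lemma vert_cases:
  assumes "x \<in> X"
  obtains w where "w \<subseteq> S" "card w \<le> D" "x = vert w"
proof -
  obtain w where w: "w \<subseteq> S" "x = vert w" using assms by (auto simp: verts_eq)
  show ?thesis
  proof (cases "card w \<le> D")
    case False
    then have "S - w \<subseteq> S" "card (S - w) \<le> D" "x = vert (S - w)"
      using w vert_compl card_compl by auto
    then show ?thesis using that by blast
  qed (use w that in blast)
qed

text \<open>Exchanging the halves of a vertex complements the symmetric difference, so every
  labelling gives the same minimum.\<close>

lemma dist_vert:
  assumes "w \<subseteq> S" "w' \<subseteq> S"
  shows "fc_dist p (vert w) (vert w') = min (card (sym_diff w w')) (2 * D - card (sym_diff w w'))"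
proof -
  have sub: "sym_diff w w' \<subseteq> S" using assms by auto
  have c: "card (S - sym_diff w w') = 2 * D - card (sym_diff w w')" by (rule card_compl[OF sub])
  have e: "sym_diff w (S - w') = S - sym_diff w w'" "sym_diff (S - w) w' = S - sym_diff w w'"
    "sym_diff (S - w) (S - w') = sym_diff w w'" using assms by auto
  show ?thesis
    using p_vert[OF assms(1)] p_vert[OF assms(2)]
    by (elim disjE) (simp_all add: fc_dist_def e c min.commute)
qed

section \<open>Neighbours and the adjacency matrix\<close>

lemma toggle_sub: "w \<subseteq> S \<Longrightarrow> z \<in> S \<Longrightarrow> toggle z w \<subseteq> S"
  by (auto simp: toggle_def)

lemma sym_diff_toggle: "sym_diff (toggle z w) w' = toggle z (sym_diff w w')"
  by (auto simp: toggle_def)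

lemma sym_diff_card_1:
  assumes "card (sym_diff w w') = 1"
  obtains z where "z \<in> sym_diff w w'" "w' = toggle z w"
proof -
  obtain z where z: "sym_diff w w' = {z}" using assms card_1_singletonE by blast
  have "w' = sym_diff w (sym_diff w w')" by blast
  also have "\<dots> = toggle z w" unfolding z by (auto simp: toggle_def)
  finally have "w' = toggle z w" .
  moreover have "z \<in> sym_diff w w'" unfolding z by simp
  ultimately show ?thesis by (rule that[rotated])
qed

lemma neighbours_vert:
  assumes w: "w \<subseteq> S"
  shows "{y \<in> X. fc_dist p (vert w) y = 1} = (\<lambda>z. vert (toggle z w)) ` S"
proof
  show "{y \<in> X. fc_dist p (vert w) y = 1} \<subseteq> (\<lambda>z. vert (toggle z w)) ` S"
  proof
    fix y assume y: "y \<in> {y \<in> X. fc_dist p (vert w) y = 1}"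
    then obtain w' where w': "w' \<subseteq> S" "y = vert w'" by (auto simp: verts_eq)
    have "card (sym_diff w w') = 1 \<or> 2 * D - card (sym_diff w w') = 1"
      using y w' dist_vert[OF w w'(1)] by (auto simp: min_def split: if_splits)
    then have "\<exists>v\<subseteq>S. y = vert v \<and> card (sym_diff w v) = 1"
    proof
      assume a: "2 * D - card (sym_diff w w') = 1"
      have "sym_diff w (S - w') = S - sym_diff w w'" using w w' by auto
      moreover have "sym_diff w w' \<subseteq> S" using w w' by auto
      ultimately have "card (sym_diff w (S - w')) = 1" using a card_compl by simp
      moreover have "S - w' \<subseteq> S" by auto
      ultimately show ?thesis using w' vert_compl by metis
    qed (use w' in auto)
    then obtain v where v: "v \<subseteq> S" "y = vert v" "card (sym_diff w v) = 1" by blast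
    obtain z where "z \<in> sym_diff w v" "v = toggle z w" using sym_diff_card_1[OF v(3)] by blast
    then show "y \<in> (\<lambda>z. vert (toggle z w)) ` S" using v w by blast
  qed
  show "(\<lambda>z. vert (toggle z w)) ` S \<subseteq> {y \<in> X. fc_dist p (vert w) y = 1}"
  proof clarify
    fix z assume z: "z \<in> S"
    have "sym_diff w (toggle z w) = {z}" by (auto simp: toggle_def)
    then show "vert (toggle z w) \<in> X \<and> fc_dist p (vert w) (vert (toggle z w)) = 1"
      using dist_vert[OF w toggle_sub[OF w z]] toggle_sub[OF w z] D_ge_3 by simp
  qed
qed

text \<open>Two toggled sets could be complementary only if \<open>S\<close> had no points besides
  \<open>z\<close> and \<open>z'\<close>, which \<open>2 * D > 2\<close> excludes.\<close>

lemma inj_on_vert_toggle: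
  assumes w: "w \<subseteq> S"
  shows "inj_on (\<lambda>z. vert (toggle z w)) S"
proof (rule inj_onI)
  fix z z' assume z: "z \<in> S" "z' \<in> S" and eq: "vert (toggle z w) = vert (toggle z' w)"
  have "toggle z' w \<noteq> S - toggle z w"
  proof
    assume "toggle z' w = S - toggle z w"
    then have "S \<subseteq> {z, z'}" by (auto simp: toggle_def split: if_splits)
    then have "2 * D \<le> card {z, z'}" using card_mono[of "{z, z'}" S] by simp
    also have "\<dots> \<le> 2" by (simp add: card_insert_if)
    finally show False using D_ge_3 by simp
  qed
  then have "toggle z' w = toggle z w"
    using eq vert_eq_iff[OF toggle_sub[OF w z(1)] toggle_sub[OF w z(2)]] by simp
  moreover have "sym_diff w (toggle z'' w) = {z''}" for z'' by (auto simp: toggle_def)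
  ultimately have "{z'} = {z}" by metis
  then show "z = z'" by simp
qed

lemma sum_A1:
  assumes w: "w \<subseteq> S"
  shows "(\<Sum>y\<in>X. fc_A D p 1 (vert w) y * f y) = (\<Sum>z\<in>S. f (vert (toggle z w)))"
proof -
  have "(\<Sum>y\<in>X. fc_A D p 1 (vert w) y * f y) = (\<Sum>y\<in>X. if fc_dist p (vert w) y = 1 then f y else 0)"
    using w by (intro sum.cong) (auto simp: fc_A_def)
  also have "\<dots> = (\<Sum>y\<in>{y \<in> X. fc_dist p (vert w) y = 1}. f y)"
    by (simp add: sum.inter_filter)
  also have "\<dots> = (\<Sum>z\<in>S. f (vert (toggle z w)))"
    unfolding neighbours_vert[OF w] by (subst sum.reindex[OF inj_on_vert_toggle[OF w]]) simp
  finally show ?thesis .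
qed

lemma sum_toggle:
  assumes w: "w \<subseteq> S"
  shows "(\<Sum>z\<in>S. F (toggle z w)) = (\<Sum>z\<in>w. F (w - {z})) + (\<Sum>z\<in>S - w. F (insert z w))"
proof -
  have "(\<Sum>z\<in>S. F (toggle z w)) = (\<Sum>z\<in>S - w. F (toggle z w)) + (\<Sum>z\<in>w. F (toggle z w))"
    by (rule sum.subset_diff[OF w finite_S])
  also have "(\<Sum>z\<in>S - w. F (toggle z w)) = (\<Sum>z\<in>S - w. F (insert z w))"
    by (intro sum.cong) (auto simp: toggle_def)
  also have "(\<Sum>z\<in>w. F (toggle z w)) = (\<Sum>z\<in>w. F (w - {z}))"
    by (intro sum.cong) (auto simp: toggle_def)
  finally show ?thesis by (simp add: add.commute)
qed

lemma mat_vec_A1: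
  assumes w: "w \<subseteq> S"
  shows "mat_vec X (fc_A D p 1) f (vert w) =
    (\<Sum>z\<in>w. f (vert (w - {z}))) + (\<Sum>z\<in>S - w. f (vert (insert z w)))"
  unfolding mat_vec_def sum_A1[OF w] by (rule sum_toggle[OF w])

lemma dist_sym: "x \<in> X \<Longrightarrow> y \<in> X \<Longrightarrow> fc_dist p x y = fc_dist p y x"
  by (auto simp: verts_eq dist_vert Un_commute)

lemma A_sym: "fc_A D p k x y = fc_A D p k y x"
  by (auto simp: fc_A_def dist_sym)

lemma cinner_A: "cinner X (mat_vec X (fc_A D p k) f) g = cinner X f (mat_vec X (fc_A D p k) g)"
proof -
  have "cnj (fc_A D p k x y) = fc_A D p k y x" for x y
    using A_sym[of k x y] by (simp add: fc_A_def)
  moreover have "cinner X (mat_vec X (fc_A D p k) f) g = (\<Sum>x\<in>X. \<Sum>y\<in>X. fc_A D p k x y * f y * cnj (g x))"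
    by (simp add: cinner_def mat_vec_def sum_distrib_right)
  ultimately show ?thesis
    by (subst (asm) sum.swap) (simp add: cinner_def mat_vec_def sum_distrib_left ac_simps)
qed

text \<open>A vertex of level \<open>r < D\<close> has exactly one half of size \<open>r\<close>, so
  the \<open>r\<close>-subsets enumerate the level without repetition.\<close>

lemma sum_level:
  assumes r: "r < D" and F: "\<And>x. x \<in> X \<Longrightarrow> level x \<noteq> r \<Longrightarrow> F x = 0"
  shows "(\<Sum>x\<in>X. F x) = (\<Sum>y | y \<subseteq> S \<and> card y = r. F (vert y))"
proof -
  have "(\<Sum>x\<in>X. F x) = (\<Sum>x\<in>vert ` {y. y \<subseteq> S \<and> card y = r}. F x)"
  proof (rule sum.mono_neutral_right)
    show "\<forall>x\<in>X - vert ` {y. y \<subseteq> S \<and> card y = r}. F x = 0"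
    proof
      fix x assume x: "x \<in> X - vert ` {y. y \<subseteq> S \<and> card y = r}"
      then obtain w where w: "w \<subseteq> S" "card w \<le> D" "x = vert w" using vert_cases by blast
      then have "card w \<noteq> r" using x by blast
      then show "F x = 0" using F x w level_vert by auto
    qed
  qed auto
  also have "\<dots> = (\<Sum>y | y \<subseteq> S \<and> card y = r. F (vert y))"
  proof -
    have "inj_on vert {y. y \<subseteq> S \<and> card y = r}"
    proof (rule inj_onI)
      fix y y' assume a: "y \<in> {y. y \<subseteq> S \<and> card y = r}" "y' \<in> {y. y \<subseteq> S \<and> card y = r}"
        "vert y = vert y'"
      then have "card (S - y) \<noteq> r" using r card_compl by auto
      then show "y = y'" using a vert_eq_iff by blast
    qed
    then show ?thesis by (simp add: sum.reindex)
  qed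
  finally show ?thesis .
qed

section \<open>The matrices \<open>M\<^sup>t\<^sub>i\<^sub>,\<^sub>j\<close> and the spaces
  \<open>\<L>\<^sub>r\<close> in terms of subsets\<close>

lemma M_vert_less:
  assumes "w \<subseteq> S" "card w < D" "y \<subseteq> S" "card y < D"
  shows "fc_M D p i r t (vert w) (vert y) = (if card w = i \<and> card y = r \<and> card (w \<inter> y) = t then 1 else 0)"
  using assms by (simp add: fc_M_def fc_triple_def p_vert_less)

lemma M_vert_D:
  assumes w: "w \<subseteq> S" "card w = D" and y: "y \<subseteq> S" "card y < D"
  shows "fc_M D p i r t (vert w) (vert y) =
    (if D = i \<and> card y = r \<and> max (card (w \<inter> y)) (card ((S - w) \<inter> y)) = t then 1 else 0)"
proof -
  have "card (S - w) = D" using w card_compl by simp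
  then show ?thesis
    using p_vert[OF w(1)] p_vert_less[OF y] w y
    by (elim disjE) (simp_all add: fc_M_def fc_triple_def max.commute)
qed

lemma M_nonzero_level:
  "fc_M D p i j t x y \<noteq> 0 \<Longrightarrow> level x = i \<and> level y = j"
  by (auto simp: fc_M_def fc_triple_def level_def Let_def split: if_splits prod.splits)

lemma mat_vec_M_level: "level x \<noteq> i \<Longrightarrow> mat_vec X (fc_M D p i j t) \<xi> x = 0"
  unfolding mat_vec_def by (intro sum.neutral ballI) (metis M_nonzero_level mult_zero_left)

lemma mat_vec_M_vecs: "mat_vec X (fc_M D p i j t) \<xi> \<in> vecs X"
  by (auto simp: vecs_def mat_vec_def fc_M_def)

lemma mat_vec_M_vert:
  assumes r: "r < D"
  shows "mat_vec X (fc_M D p i r t) \<xi> x =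
    (\<Sum>y | y \<subseteq> S \<and> card y = r. fc_M D p i r t x (vert y) * \<xi> (vert y))"
  unfolding mat_vec_def
proof (rule sum_level[OF r])
  fix y assume "level y \<noteq> r"
  then show "fc_M D p i r t x y * \<xi> y = 0" using M_nonzero_level[of i r t x y] by auto
qed

lemma subset_iff_card_Int: "finite y \<Longrightarrow> y \<subseteq> w \<longleftrightarrow> card (w \<inter> y) = card y"
  by (metis Int_absorb1 Int_lower2 card_subset_eq inf_commute)

lemma mat_vec_M_less:
  assumes w: "w \<subseteq> S" "card w < D" and r: "r < D"
  shows "mat_vec X (fc_M D p (card w) r r) \<xi> (vert w) = subset_sum (\<lambda>y. \<xi> (vert y)) r w"
proof -
  have "mat_vec X (fc_M D p (card w) r r) \<xi> (vert w) =
    (\<Sum>y | y \<subseteq> S \<and> card y = r. if y \<subseteq> w then \<xi> (vert y) else 0)"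
    unfolding mat_vec_M_vert[OF r]
  proof (intro sum.cong refl)
    fix y assume "y \<in> {y. y \<subseteq> S \<and> card y = r}"
    then have y: "y \<subseteq> S" "card y = r" by auto
    then show "fc_M D p (card w) r r (vert w) (vert y) * \<xi> (vert y) = (if y \<subseteq> w then \<xi> (vert y) else 0)"
      using w r subset_iff_card_Int[OF finite_sub[OF y(1)], of w] by (simp add: M_vert_less)
  qed
  also have "\<dots> = (\<Sum>y\<in>{y \<in> {y. y \<subseteq> S \<and> card y = r}. y \<subseteq> w}. \<xi> (vert y))"
    by (subst sum.inter_filter) auto
  also have "{y \<in> {y. y \<subseteq> S \<and> card y = r}. y \<subseteq> w} = {y. y \<subseteq> w \<and> card y = r}" using w by auto
  finally show ?thesis by (simp add: subset_sum_def)
qed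

text \<open>At level \<open>D\<close> the maximum in the triple admits \<open>r\<close>-subsets of
  either half. The two families are disjoint unless \<open>r = 0\<close>, where both consist of the
  empty set alone.\<close>

lemma mat_vec_M_D:
  assumes w: "w \<subseteq> S" "card w = D" and r: "r < D"
  shows "mat_vec X (fc_M D p D r r) \<xi> (vert w) =
    (if r = 0 then subset_sum (\<lambda>y. \<xi> (vert y)) r w
     else subset_sum (\<lambda>y. \<xi> (vert y)) r w + subset_sum (\<lambda>y. \<xi> (vert y)) r (S - w))"
proof -
  have "mat_vec X (fc_M D p D r r) \<xi> (vert w) =
    (\<Sum>y | y \<subseteq> S \<and> card y = r. if y \<subseteq> w \<or> y \<subseteq> S - w then \<xi> (vert y) else 0)"
    unfolding mat_vec_M_vert[OF r]
  proof (intro sum.cong refl)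
    fix y assume "y \<in> {y. y \<subseteq> S \<and> card y = r}"
    then have y: "y \<subseteq> S" "card y = r" "finite y" using finite_sub by auto
    have "max (card (w \<inter> y)) (card ((S - w) \<inter> y)) = r \<longleftrightarrow> card (w \<inter> y) = r \<or> card ((S - w) \<inter> y) = r"
      using card_mono[of y "w \<inter> y"] card_mono[of y "(S - w) \<inter> y"] y by (auto simp: max_def)
    then show "fc_M D p D r r (vert w) (vert y) * \<xi> (vert y) =
        (if y \<subseteq> w \<or> y \<subseteq> S - w then \<xi> (vert y) else 0)"
      using w r y subset_iff_card_Int[OF y(3)] by (simp add: M_vert_D)
  qed
  also have "\<dots> = (\<Sum>y\<in>{y \<in> {y. y \<subseteq> S \<and> card y = r}. y \<subseteq> w \<or> y \<subseteq> S - w}. \<xi> (vert y))"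
    by (subst sum.inter_filter) auto
  also have "{y \<in> {y. y \<subseteq> S \<and> card y = r}. y \<subseteq> w \<or> y \<subseteq> S - w} =
     {y. y \<subseteq> w \<and> card y = r} \<union> {y. y \<subseteq> S - w \<and> card y = r}" using w by auto
  finally have sum: "mat_vec X (fc_M D p D r r) \<xi> (vert w) =
     (\<Sum>y\<in>{y. y \<subseteq> w \<and> card y = r} \<union> {y. y \<subseteq> S - w \<and> card y = r}. \<xi> (vert y))" .
  have finw: "finite w" using w finite_sub by blast
  show ?thesis
  proof (cases "r = 0")
    case True
    then have "{y. y \<subseteq> w \<and> card y = r} = {{}}" "{y. y \<subseteq> S - w \<and> card y = r} = {{}}"
      using finw by (auto dest: finite_subset)
    then show ?thesis using True sum by (simp add: subset_sum_def)
  next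
    case False
    have disj: "{y. y \<subseteq> w \<and> card y = r} \<inter> {y. y \<subseteq> S - w \<and> card y = r} = {}"
    proof (rule equals0I)
      fix y assume y: "y \<in> {y. y \<subseteq> w \<and> card y = r} \<inter> {y. y \<subseteq> S - w \<and> card y = r}"
      then have "y \<subseteq> w" "y \<subseteq> S - w" by simp_all
      then have "y = {}" by blast
      then show False using y False by simp
    qed
    have "mat_vec X (fc_M D p D r r) \<xi> (vert w) =
        subset_sum (\<lambda>y. \<xi> (vert y)) r w + subset_sum (\<lambda>y. \<xi> (vert y)) r (S - w)"
      unfolding sum subset_sum_def by (rule sum.union_disjoint) (use finw disj in simp_all)
    then show ?thesis using False by (simp only: if_False)
  qed
qed

text \<open>At an \<open>(r - 1)\<close>-set \<open>w\<close> the defining matrix sums over the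
  \<open>r\<close>-sets containing \<open>w\<close>, which are the sets \<open>insert z w\<close>.
  As \<open>r < D\<close>, all labels involved are forced.\<close>

lemma L_iff_harmonic:
  assumes r: "r < D"
  shows "\<xi> \<in> fc_L D p r \<longleftrightarrow> \<xi> \<in> vecs X \<and> (\<forall>x\<in>X. level x \<noteq> r \<longrightarrow> \<xi> x = 0) \<and>
     harmonic S r (\<lambda>y. \<xi> (vert y))"
proof (cases r)
  case 0
  then show ?thesis by (auto simp: fc_L_def level_def harmonic_def)
next
  case (Suc k)
  have "mat_vec X (fc_M D p k r k) \<xi> (vert w) = (\<Sum>z\<in>S - w. \<xi> (vert (insert z w)))"
    if w: "w \<subseteq> S" "card w = k" for w
  proof -
    have finw: "finite w" using w finite_sub by blast
    have "mat_vec X (fc_M D p k r k) \<xi> (vert w) =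
      (\<Sum>y | y \<subseteq> S \<and> card y = r. if w \<subseteq> y then \<xi> (vert y) else 0)"
      unfolding mat_vec_M_vert[OF r]
    proof (intro sum.cong refl)
      fix y assume "y \<in> {y. y \<subseteq> S \<and> card y = r}"
      then have y: "y \<subseteq> S" "card y = r" by auto
      then show "fc_M D p k r k (vert w) (vert y) * \<xi> (vert y) = (if w \<subseteq> y then \<xi> (vert y) else 0)"
        using w r Suc subset_iff_card_Int[OF finw, of y] by (simp add: M_vert_less Int_commute)
    qed
    also have "\<dots> = (\<Sum>y\<in>{y \<in> {y. y \<subseteq> S \<and> card y = r}. w \<subseteq> y}. \<xi> (vert y))"
      by (subst sum.inter_filter) auto
    also have "{y \<in> {y. y \<subseteq> S \<and> card y = r}. w \<subseteq> y} = (\<lambda>z. insert z w) ` (S - w)" (is "?A = ?B")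
    proof
      show "?B \<subseteq> ?A" using w finw Suc by auto
      show "?A \<subseteq> ?B"
      proof
        fix y assume y: "y \<in> ?A"
        then have "card (y - w) = 1" using w finw Suc by (simp add: card_Diff_subset)
        then obtain z where z: "y - w = {z}" using card_1_singletonE by blast
        then have "y = insert z w" "z \<in> S - w" using y by auto
        then show "y \<in> ?B" by blast
      qed
    qed
    also have "(\<Sum>y\<in>\<dots>. \<xi> (vert y)) = (\<Sum>z\<in>S - w. \<xi> (vert (insert z w)))"
      by (subst sum.reindex) (auto simp: inj_on_def)
    finally show ?thesis .
  qed
  moreover have "mat_vec X (fc_M D p k r k) \<xi> = 0 \<longleftrightarrow>
      (\<forall>w\<subseteq>S. card w = k \<longrightarrow> mat_vec X (fc_M D p k r k) \<xi> (vert w) = 0)" (is "?L \<longleftrightarrow> ?R")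
  proof
    assume R: ?R
    show ?L
    proof
      fix x
      show "mat_vec X (fc_M D p k r k) \<xi> x = 0 x"
      proof (cases "x \<in> X \<and> level x = k")
        case True
        then obtain w where "w \<subseteq> S" "card w \<le> D" "x = vert w" using vert_cases by blast
        then show ?thesis using R True level_vert by auto
      next
        case False
        then show ?thesis using mat_vec_M_level mat_vec_M_vecs[of k r k \<xi>] by (auto simp: vecs_def)
      qed
    qed
  qed simp
  ultimately show ?thesis using Suc by (auto simp: fc_L_def level_def harmonic_def)
qed

end

section \<open>The three-term recurrence\<close>

locale folded_cube_basis = folded_cube +
  fixes B :: "nat \<Rightarrow> (vertex \<Rightarrow> complex) set"
  assumes odd_D: "odd D"
    and basis: "\<And>r. r \<le> D - 1 \<Longrightarrow> orthonormal_basis (fc_verts D) (fc_L D p r) (B r)"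
    and real: "\<And>r \<xi> x. r \<le> D - 1 \<Longrightarrow> \<xi> \<in> B r \<Longrightarrow> \<xi> x \<in> \<real>"
begin

abbreviation "R \<equiv> {0..D - 1}"
abbreviation "N \<equiv> fc_N D"
abbreviation "u \<equiv> fc_u D p"

text \<open>Normalizes the lifted sum rather than
  \<open>M\<^sup>r\<^sub>i\<^sub>,\<^sub>r \<xi>\<close>. At level \<open>D\<close> the matrix
  yields twice the lift for even \<open>r > 0\<close> and once the lift for \<open>r = 0\<close>;
  with the factors \<open>sqrt 2 / 2\<close> and \<open>sqrt 2\<close> of \<open>fc_factor\<close>
  both cases become \<open>sqrt 2\<close>.\<close>

definition kappa :: "nat \<Rightarrow> nat \<Rightarrow> real" where
  "kappa r i = (if i < D then 1 else sqrt 2) * real ((2 * D - 2 * r) choose (i - r)) powr (- 1 / 2)"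

text \<open>Read off from the upward part of \<open>A\<^sub>1\<close>: removing a point from an
  \<open>(i + 1)\<close>-set in all ways multiplies the lift by \<open>i + 1 - r\<close>. If
  \<open>Suc i = D\<close> and \<open>r\<close> is even, adding points contributes the same amount
  again.\<close>

definition alpha :: "nat \<Rightarrow> nat \<Rightarrow> real" where
  "alpha r i = kappa r i * (real (Suc i) - real r) * (if Suc i = D then 2 else 1) / kappa r (Suc i)"

abbreviation "tri \<equiv> block_tridiag R N (\<lambda>r i. complex_of_real (alpha r i))"

lemma N_le: "i \<in> N r \<Longrightarrow> r \<le> i \<and> i \<le> D"
  by (auto simp: fc_N_def split: if_splits)

lemma R_less: "r \<in> R \<Longrightarrow> r < D"
  using D_ge_3 by auto

lemma B_L: "r \<in> R \<Longrightarrow> \<xi> \<in> B r \<Longrightarrow> \<xi> \<in> fc_L D p r"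
  using basis[of r] cfun.span_base[of \<xi> "B r"] by (auto simp: orthonormal_basis_def)

lemma binomial_pos: "r \<le> i \<Longrightarrow> i \<le> D \<Longrightarrow> 0 < (2 * D - 2 * r) choose (i - r)"
  by (simp add: zero_less_binomial_iff)

lemma kappa_pos: "r \<le> i \<Longrightarrow> i \<le> D \<Longrightarrow> 0 < kappa r i"
  using binomial_pos[of r i] by (simp add: kappa_def)

lemma kappa_square:
  assumes "r \<le> i" "i \<le> D"
  shows "kappa r i * kappa r i = (if i < D then 1 else 2) / real ((2 * D - 2 * r) choose (i - r))"
proof -
  let ?c = "real ((2 * D - 2 * r) choose (i - r))"
  have "?c > 0" using binomial_pos[OF assms] by simp
  then have "?c powr (- 1 / 2) * ?c powr (- 1 / 2) = 1 / ?c"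
    by (simp add: powr_add[symmetric] powr_minus_divide)
  moreover have "kappa r i * kappa r i =
     (if i < D then 1 else sqrt 2) * (if i < D then 1 else sqrt 2) * (?c powr (- 1 / 2) * ?c powr (- 1 / 2))"
    by (simp add: kappa_def)
  ultimately show ?thesis by simp
qed

lemma alpha_up:
  assumes "r \<le> i" "Suc i \<le> D"
  shows "alpha r i * kappa r (Suc i) = kappa r i * (real (Suc i) - real r) * (if Suc i = D then 2 else 1)"
  using kappa_pos[of r "Suc i"] assms by (simp add: alpha_def)

text \<open>The coefficient of the upward part also serves the downward part, which is the symmetry
  of the recurrence. It rests on \<open>(m - k) * (m choose k) = Suc k * (m choose Suc k)\<close>
  for \<open>m = 2 * D - 2 * r\<close> and \<open>k = i - r\<close>; the 2 at level \<open>D\<close>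
  matches the square of \<open>sqrt 2\<close> in \<open>kappa\<close>.\<close>

lemma alpha_down:
  assumes "r \<le> i" "Suc i \<le> D"
  shows "alpha r i * kappa r i = kappa r (Suc i) * (real (2 * D) - real i - real r)"
proof -
  let ?m = "2 * D - 2 * r" and ?k = "i - r"
  have pos: "0 < real (?m choose ?k)" "0 < real (?m choose Suc ?k)"
    using binomial_pos[of r i] binomial_pos[of r "Suc i"] assms by (auto simp: Suc_diff_le)
  have "(?m - ?k) * (?m choose ?k) = Suc ?k * (?m choose Suc ?k)"
    by (metis binomial_absorb_comp binomial_absorption mult.commute)
  then have "real (?m - ?k) * real (?m choose ?k) = real (Suc ?k) * real (?m choose Suc ?k)"
    by (metis of_nat_mult)
  moreover have "real (?m - ?k) = real (2 * D) - real i - real r" "real (Suc ?k) = real (Suc i) - real r"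
    using assms by (auto simp: of_nat_diff)
  ultimately have bin: "(real (2 * D) - real i - real r) * real (?m choose ?k) =
      (real (Suc i) - real r) * real (?m choose Suc ?k)" by (simp only:)
  have "kappa r i * kappa r i * ((real (Suc i) - real r) * (if Suc i = D then 2 else 1)) =
        kappa r (Suc i) * kappa r (Suc i) * (real (2 * D) - real i - real r)"
    using assms pos bin by (subst (1 2) kappa_square) (auto simp: Suc_diff_le field_simps)
  then show ?thesis
    using kappa_pos[of r "Suc i"] assms by (simp add: alpha_def field_simps)
qed

lemma alpha_nonzero: "r \<le> i \<Longrightarrow> Suc i \<le> D \<Longrightarrow> alpha r i \<noteq> 0"
  using kappa_pos[of r i] kappa_pos[of r "Suc i"] by (auto simp: alpha_def)

lemma L_harmonic: "r < D \<Longrightarrow> \<xi> \<in> fc_L D p r \<Longrightarrow> harmonic S r (\<lambda>y. \<xi> (vert y))"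
  using L_iff_harmonic by blast

text \<open>\<open>D \<in> N r\<close> forces \<open>r\<close> to be even, so both halves of a
  vertex on level \<open>D\<close> have the same lifted sum and it does not matter which one is
  \<open>w\<close>.\<close>

lemma u_vert:
  assumes r: "r < D" and xi: "\<xi> \<in> fc_L D p r" and i: "i \<in> N r" and w: "w \<subseteq> S" "card w \<le> D"
  shows "u r \<xi> i (vert w) =
    (if card w = i then complex_of_real (kappa r i) * subset_sum (\<lambda>y. \<xi> (vert y)) r w else 0)"
proof (cases "card w = i")
  case False
  then show ?thesis using level_vert[OF w] mat_vec_M_level by (simp add: fc_u_def)
next
  case True
  show ?thesis
  proof (cases "i < D")
    case i: True
    then show ?thesis
      using mat_vec_M_less[of w r \<xi>] w r True by (simp add: fc_u_def fc_factor_def kappa_def)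
  next
    case False
    then have iD: "i = D" using N_le[OF i] by simp
    then have ev: "even r" using i r odd_D by (auto simp: fc_N_def split: if_splits)
    have "subset_sum (\<lambda>y. \<xi> (vert y)) r (S - w) = subset_sum (\<lambda>y. \<xi> (vert y)) r w"
      using subset_sum_compl[OF finite_S w(1) L_harmonic[OF r xi]] ev by simp
    then show ?thesis
      using mat_vec_M_D[of w r \<xi>] w r True iD by (auto simp: fc_u_def fc_factor_def kappa_def)
  qed
qed

lemma u_level: "level x \<noteq> i \<Longrightarrow> u r \<xi> i x = 0"
  using mat_vec_M_level by (simp add: fc_u_def)

lemma u_in_vecs: "u r \<xi> i \<in> vecs X"
  using mat_vec_M_vecs[of i r r \<xi>] by (auto simp: fc_u_def vecs_def)

lemma u_base:
  assumes r: "r \<in> R" and xi: "\<xi> \<in> fc_L D p r"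
  shows "u r \<xi> r = \<xi>"
proof
  fix x
  have rD: "r < D" using R_less[OF r] .
  have xi': "\<xi> \<in> vecs X" "\<forall>x\<in>X. level x \<noteq> r \<longrightarrow> \<xi> x = 0" using L_iff_harmonic[OF rD] xi by auto
  show "u r \<xi> r x = \<xi> x"
  proof (cases "x \<in> X")
    case True
    then obtain w where w: "w \<subseteq> S" "card w \<le> D" "x = vert w" using vert_cases by blast
    have "r \<in> N r" using r by (auto simp: fc_N_def)
    from u_vert[OF rD xi this w(1,2)] show ?thesis
      using w xi' True rD subset_sum_card[OF finite_sub[OF w(1)]] level_vert[OF w(1,2)]
      by (auto simp: kappa_def)
  next
    case False
    then show ?thesis using xi' u_in_vecs[of r \<xi> r] by (auto simp: vecs_def)
  qed
qed

lemma finite_N: "finite (N r)"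
  by (simp add: fc_N_def)

lemma mat_vec_A_vecs: "mat_vec X (fc_A D p k) f \<in> vecs X"
  by (auto simp: vecs_def mat_vec_def fc_A_def)

text \<open>At \<open>vert w\<close> the neighbours arise by removing a point of \<open>w\<close> or
  adding one outside; each kind contributes a multiple of the lifted sum over \<open>w\<close>, to
  be compared with the tridiagonal entry.\<close>

lemma A1_u:
  assumes r: "r \<in> R" and xi: "\<xi> \<in> fc_L D p r" and j: "j \<in> N r"
  shows "mat_vec X (fc_A D p 1) (u r \<xi> j) = (\<lambda>x. \<Sum>i\<in>N r. tri r i j * u r \<xi> i x)"
proof
  fix x
  have rD: "r < D" using R_less[OF r] .
  show "mat_vec X (fc_A D p 1) (u r \<xi> j) x = (\<Sum>i\<in>N r. tri r i j * u r \<xi> i x)"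
  proof (cases "x \<in> X")
    case False
    then show ?thesis using mat_vec_A_vecs[of 1 "u r \<xi> j"] u_in_vecs[of r \<xi>] by (simp add: vecs_def)
  next
    case True
    then obtain w where w: "w \<subseteq> S" "card w \<le> D" "x = vert w" using vert_cases by blast
    let ?H = "subset_sum (\<lambda>y. \<xi> (vert y)) r" and ?l = "card w"
    have finw: "finite w" using w finite_sub by blast
    note harm = L_harmonic[OF rD xi]
    note uv = u_vert[OF rD xi]
    have rhs: "(\<Sum>i\<in>N r. tri r i j * u r \<xi> i x) =
        (if ?l \<in> N r then tri r ?l j * complex_of_real (kappa r ?l) * ?H w else 0)"
    proof -
      have "(\<Sum>i\<in>N r. tri r i j * u r \<xi> i x) =
          (\<Sum>i\<in>N r. if ?l = i then tri r i j * complex_of_real (kappa r i) * ?H w else 0)"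
        using w by (intro sum.cong) (auto simp: uv)
      then show ?thesis using finite_N by simp
    qed
    have s1: "(\<Sum>z\<in>w. u r \<xi> j (vert (w - {z}))) =
        (if ?l = Suc j then of_real (kappa r j * (real (Suc j) - real r)) * ?H w else 0)"
    proof -
      have "(\<Sum>z\<in>w. u r \<xi> j (vert (w - {z}))) =
         (\<Sum>z\<in>w. if ?l = Suc j then of_real (kappa r j) * ?H (w - {z}) else 0)"
      proof (intro sum.cong refl)
        fix z assume z: "z \<in> w"
        then have c: "Suc (card (w - {z})) = ?l" using card_Suc_Diff1[OF finw] by blast
        moreover have "w - {z} \<subseteq> S" using w by auto
        ultimately have "u r \<xi> j (vert (w - {z})) = 
            (if card (w - {z}) = j then of_real (kappa r j) * ?H (w - {z}) else 0)"
          using w j by (intro uv) auto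
        then show "u r \<xi> j (vert (w - {z})) = (if ?l = Suc j then of_real (kappa r j) * ?H (w - {z}) else 0)"
          using c by auto
      qed
      also have "\<dots> = (if ?l = Suc j then of_real (kappa r j) * (\<Sum>z\<in>w. ?H (w - {z})) else 0)"
        by (simp add: sum_distrib_left)
      also have "\<dots> = (if ?l = Suc j then of_real (kappa r j * (real (Suc j) - real r)) * ?H w else 0)"
        by (simp add: sum_subset_sum_remove[OF finw])
      finally show ?thesis .
    qed
    show ?thesis
    proof (cases "?l < D")
      case lD: True
      have s2: "(\<Sum>z\<in>S - w. u r \<xi> j (vert (insert z w))) =
        (if Suc ?l = j then of_real (kappa r j * (real (2 * D) - real ?l - real r)) * ?H w else 0)"
      proof -
        have "(\<Sum>z\<in>S - w. u r \<xi> j (vert (insert z w))) =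
           (\<Sum>z\<in>S - w. if Suc ?l = j then of_real (kappa r j) * ?H (insert z w) else 0)"
        proof (intro sum.cong refl)
          fix z assume z: "z \<in> S - w"
          then have "card (insert z w) = Suc ?l" "insert z w \<subseteq> S" using finw w by auto
          then show "u r \<xi> j (vert (insert z w)) =
              (if Suc ?l = j then of_real (kappa r j) * ?H (insert z w) else 0)"
            using uv[OF j, of "insert z w"] lD by auto
        qed
        also have "\<dots> = (if Suc ?l = j then of_real (kappa r j) * (\<Sum>z\<in>S - w. ?H (insert z w)) else 0)"
          by (simp add: sum_distrib_left)
        also have "\<dots> = (if Suc ?l = j then
            of_real (kappa r j * (real (2 * D) - real ?l - real r)) * ?H w else 0)"
          by (simp add: sum_subset_sum_insert[OF finite_S w(1) harm])
        finally show ?thesis .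
      qed
      have lhs: "mat_vec X (fc_A D p 1) (u r \<xi> j) x =
        (if ?l = Suc j then of_real (kappa r j * (real (Suc j) - real r)) * ?H w else 0) +
        (if Suc ?l = j then of_real (kappa r j * (real (2 * D) - real ?l - real r)) * ?H w else 0)"
        unfolding w(3) mat_vec_A1[OF w(1)] s1 s2 ..
      consider (up) "?l = Suc j" | (down) "j = Suc ?l" | (other) "?l \<noteq> Suc j" "j \<noteq> Suc ?l" by blast
      then show ?thesis
      proof cases
        case up
        have "?l \<in> N r" using up N_le[OF j] lD by (auto simp: fc_N_def)
        moreover have "alpha r j * kappa r (Suc j) = kappa r j * (real (Suc j) - real r)"
          using alpha_up[of r j] N_le[OF j] up lD by simp
        ultimately show ?thesis
          unfolding lhs rhs using up r j by (simp add: block_tridiag_def flip: of_real_mult)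
      next
        case down
        show ?thesis
        proof (cases "r \<le> ?l")
          case True
          then have "?l \<in> N r" using lD by (auto simp: fc_N_def)
          moreover have "alpha r ?l * kappa r ?l = kappa r (Suc ?l) * (real (2 * D) - real ?l - real r)"
            using alpha_down[of r ?l] True lD by simp
          ultimately show ?thesis
            unfolding lhs rhs using down r j by (simp add: block_tridiag_def flip: of_real_mult)
        next
          \<comment> \<open>Here \<open>j = r\<close> and \<open>w\<close> has \<open>r - 1\<close>
            points, so the lifted sum is empty: nothing lies below the lowest index.\<close>
          case False
          then show ?thesis unfolding lhs rhs using subset_sum_eq_0[OF finw] by simp
        qed
      next
        case other
        then show ?thesis unfolding lhs rhs by (simp add: block_tridiag_def)
      qed
    next
      case False
      then have lD: "?l = D" using w by simp
      \<comment> \<open>An added point leads to a set of size \<open>D + 1\<close>, whose vertex is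
        also named by the \<open>(D - 1)\<close>-set \<open>S - w - {z}\<close>. This is a removal
        sum over the other half, which differs from that over \<open>w\<close> by the sign
        \<open>(-1) ^ r\<close>.\<close>
      have s2: "(\<Sum>z\<in>S - w. u r \<xi> j (vert (insert z w))) =
        (if D = Suc j then of_real (kappa r j * (real (Suc j) - real r)) * ((-1) ^ r * ?H w) else 0)"
      proof -
        have cS: "card (S - w) = D" using card_compl[OF w(1)] lD by simp
        have "(\<Sum>z\<in>S - w. u r \<xi> j (vert (insert z w))) =
           (\<Sum>z\<in>S - w. if D = Suc j then of_real (kappa r j) * ?H (S - w - {z}) else 0)"
        proof (intro sum.cong refl)
          fix z assume z: "z \<in> S - w"
          have "S - insert z w = S - w - {z}" by auto
          moreover have "insert z w \<subseteq> S" using z w by auto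
          ultimately have v: "vert (insert z w) = vert (S - w - {z})" using vert_compl by metis
          have c: "Suc (card (S - w - {z})) = D" using card_Suc_Diff1[of "S - w" z] z cS by simp
          have "S - w - {z} \<subseteq> S" by auto
          from uv[OF j this] c
          show "u r \<xi> j (vert (insert z w)) = (if D = Suc j then of_real (kappa r j) * ?H (S - w - {z}) else 0)"
            unfolding v by auto
        qed
        also have "\<dots> = (if D = Suc j then of_real (kappa r j) * (\<Sum>z\<in>S - w. ?H (S - w - {z})) else 0)"
          by (simp add: sum_distrib_left)
        also have "(\<Sum>z\<in>S - w. ?H (S - w - {z})) = (of_nat D - of_nat r) * ?H (S - w)"
          using sum_subset_sum_remove[of "S - w"] cS by simp
        also have "?H (S - w) = (-1) ^ r * ?H w" by (rule subset_sum_compl[OF finite_S w(1) harm])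
        finally show ?thesis by simp
      qed
      have lhs: "mat_vec X (fc_A D p 1) (u r \<xi> j) x =
        (if D = Suc j then of_real (kappa r j * (real (Suc j) - real r)) * ?H w else 0) +
        (if D = Suc j then of_real (kappa r j * (real (Suc j) - real r)) * ((-1) ^ r * ?H w) else 0)"
        unfolding w(3) mat_vec_A1[OF w(1)] s1 s2 unfolding lD ..
      show ?thesis
      proof (cases "D = Suc j")
        case True
        show ?thesis
        \<comment> \<open>For even \<open>r\<close> the two contributions add up to the factor 2 in
          \<open>alpha\<close>; for odd \<open>r\<close> they cancel, in accordance with
          \<open>D \<notin> N r\<close>.\<close>
        proof (cases "even r")
          case ev: True
          then have "D \<in> N r" using rD by (auto simp: fc_N_def)
          then have t: "tri r D j = of_real (alpha r j)" using r j True by (simp add: block_tridiag_def)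
          have "alpha r j * kappa r D = 2 * (kappa r j * (real (Suc j) - real r))"
            using alpha_up[of r j] N_le[OF j] True by simp
          then have "complex_of_real (alpha r j) * of_real (kappa r D) =
              2 * of_real (kappa r j * (real (Suc j) - real r))"
            by (metis of_real_mult of_real_numeral)
          then show ?thesis
            unfolding lhs rhs lD using True ev \<open>D \<in> N r\<close> t by simp
        next
          case False
          then have "D \<notin> N r" using D_ge_3 by (auto simp: fc_N_def)
          then show ?thesis unfolding lhs rhs using True False lD by simp
        qed
      next
        case False
        then show ?thesis unfolding lhs rhs using N_le[OF j] lD by (auto simp: block_tridiag_def)
      qed
    qed
  qed
qed

end

section \<open>Orthonormality and completeness\<close>

context folded_cube_basis
begin

lemma cinner_levels:
  assumes "\<And>x. level x \<noteq> i \<Longrightarrow> f x = 0" "\<And>x. level x \<noteq> k \<Longrightarrow> g x = 0" "i \<noteq> k"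
  shows "cinner X f g = 0"
  unfolding cinner_def
proof (intro sum.neutral ballI)
  fix x
  have "f x = 0 \<or> g x = 0" using assms by metis
  then show "f x * cnj (g x) = 0" by auto
qed

lemma cinner_A1_u:
  assumes r: "r \<in> R" "\<xi> \<in> B r" "j \<in> N r" and g: "\<And>x. level x \<noteq> k \<Longrightarrow> g x = 0"
  shows "cinner X (mat_vec X (fc_A D p 1) (u r \<xi> j)) g =
    (if k \<in> N r then tri r k j * cinner X (u r \<xi> k) g else 0)"
proof -
  have "cinner X (mat_vec X (fc_A D p 1) (u r \<xi> j)) g = 
      cinner X (\<Sum>i\<in>N r. (\<lambda>x. tri r i j * u r \<xi> i x)) g"
    unfolding A1_u[OF r(1) B_L[OF r(1,2)] r(3)] by (simp add: cinner_def sum_fun_apply)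
  also have "\<dots> = (\<Sum>i\<in>N r. tri r i j * cinner X (u r \<xi> i) g)" by (rule cinner_sum_left)
  also have "\<dots> = (\<Sum>i\<in>N r. if i = k then tri r k j * cinner X (u r \<xi> k) g else 0)"
  proof (intro sum.cong refl)
    fix i
    have "cinner X (u r \<xi> i) g = 0" if "i \<noteq> k"
      using u_level g that by (rule cinner_levels)
    then show "tri r i j * cinner X (u r \<xi> i) g = (if i = k then tri r k j * cinner X (u r \<xi> k) g else 0)"
      by auto
  qed
  finally show ?thesis using finite_N by simp
qed

lemma tri_Suc:
  "r \<in> R \<Longrightarrow> Suc i \<in> N r \<Longrightarrow> i \<in> N r \<Longrightarrow>
     tri r (Suc i) i = of_real (alpha r i) \<and> tri r i (Suc i) = of_real (alpha r i)"
  by (simp add: block_tridiag_def)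

lemma N_Suc: "Suc i \<in> N r \<Longrightarrow> r \<le> i \<Longrightarrow> i \<in> N r"
  by (auto simp: fc_N_def split: if_splits)

lemma alpha_N: "i \<in> N r \<Longrightarrow> Suc i \<in> N r \<Longrightarrow> alpha r i \<noteq> 0"
  using alpha_nonzero N_le by blast

text \<open>The inner product of \<open>A\<^sub>1 (u r \<xi> i)\<close> with
  \<open>u s \<eta> (Suc i)\<close> is evaluated with \<open>A\<^sub>1\<close> on either side. If
  \<open>s = Suc i\<close>, the second vector sits at its lowest index and \<open>A\<^sub>1\<close>
  has nothing to send down.\<close>

lemma cinner_u_Suc:
  assumes r: "r \<in> R" "\<xi> \<in> B r" "Suc i \<in> N r" "r \<le> i" and s: "s \<in> R" "\<eta> \<in> B s" "Suc i \<in> N s"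
  shows "of_real (alpha r i) * cinner X (u r \<xi> (Suc i)) (u s \<eta> (Suc i)) =
    (if s \<le> i then of_real (alpha s i) * cinner X (u r \<xi> i) (u s \<eta> i) else 0)"
proof -
  have iN: "i \<in> N r" using N_Suc r by blast
  have "of_real (alpha r i) * cinner X (u r \<xi> (Suc i)) (u s \<eta> (Suc i)) =
      cinner X (mat_vec X (fc_A D p 1) (u r \<xi> i)) (u s \<eta> (Suc i))"
    using cinner_A1_u[OF r(1,2) iN, of "Suc i" "u s \<eta> (Suc i)"] u_level tri_Suc r iN by simp
  also have "\<dots> = cnj (cinner X (mat_vec X (fc_A D p 1) (u s \<eta> (Suc i))) (u r \<xi> i))"
    by (simp only: cinner_A cinner_cnj)
  also have "cinner X (mat_vec X (fc_A D p 1) (u s \<eta> (Suc i))) (u r \<xi> i) =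
      (if i \<in> N s then tri s i (Suc i) * cinner X (u s \<eta> i) (u r \<xi> i) else 0)"
    using u_level by (intro cinner_A1_u[OF s]) auto
  also have "cnj \<dots> = (if s \<le> i then of_real (alpha s i) * cinner X (u r \<xi> i) (u s \<eta> i) else 0)"
  proof (cases "s \<le> i")
    case True
    then have "i \<in> N s" using N_Suc s by blast
    then show ?thesis using True tri_Suc s by (simp add: cinner_cnj)
  next
    case False
    then have "i \<notin> N s" using N_le by blast
    then show ?thesis using False by simp
  qed
  finally show ?thesis .
qed

text \<open>The vectors that start at level \<open>i\<close> form the basis \<open>B i\<close>; all
  other inner products come from the level below. For equal pairs the two \<open>alpha\<close>
  factors coincide and cancel.\<close>

lemma cinner_u_same_level:
  assumes "r \<in> R" "\<xi> \<in> B r" "i \<in> N r" "s \<in> R" "\<eta> \<in> B s" "i \<in> N s"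
  shows "cinner X (u r \<xi> i) (u s \<eta> i) = (if (r, \<xi>) = (s, \<eta>) then 1 else 0)"
  using assms
proof (induction i arbitrary: r \<xi> s \<eta>)
  have base: "cinner X (u r \<xi> r) (u r \<eta> r) = (if \<xi> = \<eta> then 1 else 0)"
    if "r \<in> R" "\<xi> \<in> B r" "\<eta> \<in> B r" for r \<xi> \<eta>
    using that u_base B_L basis[of r] by (simp add: orthonormal_basis_def)
  {
    case 0
    then have "r = 0" "s = 0" using N_le by auto
    then show ?case using 0 base by simp
  next
    case (Suc i)
    \<comment> \<open>Only the first vector is required to start below; the case
      \<open>s \<le> i\<close> follows by conjugation.\<close>
    have main: "cinner X (u r \<xi> (Suc i)) (u s \<eta> (Suc i)) = (if (r, \<xi>) = (s, \<eta>) then 1 else 0)"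
      if a: "r \<in> R" "\<xi> \<in> B r" "Suc i \<in> N r" "r \<le> i" "s \<in> R" "\<eta> \<in> B s" "Suc i \<in> N s" for r s \<xi> \<eta>
    proof -
      have "i \<in> N r" using N_Suc a by blast
      then have nz: "alpha r i \<noteq> 0" using alpha_N a by blast
      have eq: "of_real (alpha r i) * cinner X (u r \<xi> (Suc i)) (u s \<eta> (Suc i)) =
        (if s \<le> i then of_real (alpha s i) * cinner X (u r \<xi> i) (u s \<eta> i) else 0)"
        by (rule cinner_u_Suc[OF a])
      show ?thesis
      proof (cases "s \<le> i")
        case True
        then have "i \<in> N s" using N_Suc a by blast
        then have "cinner X (u r \<xi> i) (u s \<eta> i) = (if (r, \<xi>) = (s, \<eta>) then 1 else 0)"
          using a \<open>i \<in> N r\<close> by (intro Suc.IH)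
        then show ?thesis using eq nz True by (auto split: if_splits)
      next
        case False
        then show ?thesis using eq nz a by auto
      qed
    qed
    consider "r \<le> i" | "s \<le> i" | "r = Suc i" "s = Suc i" using N_le Suc.prems by (meson le_Suc_eq)
    then show ?case
    proof cases
      case 1
      then show ?thesis using main Suc.prems by simp
    next
      case 2
      have "cinner X (u s \<eta> (Suc i)) (u r \<xi> (Suc i)) = (if (s, \<eta>) = (r, \<xi>) then 1 else 0)"
        using 2 Suc.prems by (intro main)
      then show ?thesis using cinner_cnj[of X "u s \<eta> (Suc i)" "u r \<xi> (Suc i)"] by (auto split: if_splits)
    next
      case 3
      then show ?thesis using base[of "Suc i" \<xi> \<eta>] Suc.prems by simp
    qed
  }
qed

lemma cinner_u:
  assumes "r \<in> R" "\<xi> \<in> B r" "i \<in> N r" "s \<in> R" "\<eta> \<in> B s" "j \<in> N s"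
  shows "cinner X (u r \<xi> i) (u s \<eta> j) = (if (r, \<xi>, i) = (s, \<eta>, j) then 1 else 0)"
proof (cases "i = j")
  case True
  then show ?thesis using cinner_u_same_level assms by simp
next
  case False
  have "cinner X (u r \<xi> i) (u s \<eta> j) = 0"
    using u_level u_level False by (rule cinner_levels)
  then show ?thesis using False by simp
qed

text \<open>
  By induction on the level, a vector orthogonal to the basis is annihilated by the lowering
  operator, hence lies in \<open>\<L>\<^sub>i\<close>. On level \<open>D\<close> such a vector is zero: a lift to
  \<open>D\<close>-subsets is invariant under complementation, while a harmonic function of odd degree changes
  sign.
\<close>

lemma complete_level:
  assumes "i \<le> D" "f \<in> vecs X" "\<And>x. level x \<noteq> i \<Longrightarrow> f x = 0"
    "\<And>r \<xi>. r \<in> R \<Longrightarrow> \<xi> \<in> B r \<Longrightarrow> i \<in> N r \<Longrightarrow> cinner X f (u r \<xi> i) = 0"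
  shows "f = 0"
  using assms
proof (induction i arbitrary: f)
  \<comment> \<open>The conclusion once harmonicity is known. Below level \<open>D\<close>,
    \<open>f\<close> lies in the span of \<open>B i\<close> and is orthogonal to it, since
    \<open>u i \<xi> i = \<xi>\<close>.\<close>
  have fin: "f = 0" if i: "i \<le> D" and f: "f \<in> vecs X" "\<And>x. level x \<noteq> i \<Longrightarrow> f x = 0"
    "\<And>r \<xi>. r \<in> R \<Longrightarrow> \<xi> \<in> B r \<Longrightarrow> i \<in> N r \<Longrightarrow> cinner X f (u r \<xi> i) = 0"
    and harm: "harmonic S i (\<lambda>y. f (vert y))" for i f
  proof (cases "i < D")
    case True
    then have iR: "i \<in> R" by auto
    have iN: "i \<in> N i" using True by (auto simp: fc_N_def)
    have "f \<in> fc_L D p i" using L_iff_harmonic[OF True] f harm by blast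
    then have "f \<in> cspan (B i)" using basis[of i] iR by (simp add: orthonormal_basis_def)
    moreover have "cinner X \<xi> f = 0" if "\<xi> \<in> B i" for \<xi>
      using f(3)[OF iR that iN] u_base[OF iR B_L[OF iR that]] cinner_cnj[of X f \<xi>] by simp
    moreover have "cfun.subspace {v. cinner X v f = 0}"
      by (auto simp: cfun.subspace_def cinner_def distrib_right sum.distrib mult.assoc sum_distrib_left[symmetric])
    ultimately have "cinner X f f = 0"
      using cfun.span_minimal[of "B i" "{v. cinner X v f = 0}"] by blast
    then show ?thesis using cinner_self_eq_0 f(1) finite_X by blast
  next
    case False
    then have iD: "i = D" using i by simp
    show ?thesis
    proof
      fix x
      show "f x = 0 x"
      proof (cases "x \<in> X \<and> level x = D")
        case True
        then obtain w where w: "w \<subseteq> S" "card w \<le> D" "x = vert w" using vert_cases by blast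
        then have cw: "card w = D" using level_vert True by simp
        have "card (S - w) = D" using card_compl[OF w(1)] cw by simp
        then have "subset_sum (\<lambda>y. f (vert y)) D (S - w) = f (vert (S - w))"
          using subset_sum_card[of "S - w"] by simp
        moreover have "subset_sum (\<lambda>y. f (vert y)) D w = f (vert w)"
          using subset_sum_card[OF finite_sub[OF w(1)]] cw by metis
        ultimately have "f (vert (S - w)) = - f (vert w)"
          using subset_sum_compl[OF finite_S w(1), of D "\<lambda>y. f (vert y)"] harm iD odd_D by simp
        then show ?thesis using w vert_compl by simp
      next
        case False
        then show ?thesis using f iD by (auto simp: vecs_def)
      qed
    qed
  qed
  {
    case (0 f)
    show ?case by (rule fin[of 0]) (use 0 in \<open>auto simp: harmonic_def\<close>)
  next
    case (Suc i f)
    \<comment> \<open>The level-\<open>i\<close> part of \<open>A\<^sub>1 f\<close>. By symmetry of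
      \<open>A\<^sub>1\<close> its inner products with the basis are multiples of those of
      \<open>f\<close> one level up, hence zero.\<close>
    let ?g = "\<lambda>x. if level x = i then mat_vec X (fc_A D p 1) f x else 0"
    have g0: "?g = 0"
    proof (rule Suc.IH)
      show "?g \<in> vecs X" using mat_vec_A_vecs[of 1 f] by (auto simp: vecs_def)
      fix r \<xi> assume a: "r \<in> R" "\<xi> \<in> B r" "i \<in> N r"
      have "cinner X ?g (u r \<xi> i) = cinner X (mat_vec X (fc_A D p 1) f) (u r \<xi> i)"
        unfolding cinner_def using u_level[of _ i r \<xi>] by (intro sum.cong) auto
      also have "\<dots> = cnj (cinner X (mat_vec X (fc_A D p 1) (u r \<xi> i)) f)"
        by (simp only: cinner_A cinner_cnj)
      also have "cinner X (mat_vec X (fc_A D p 1) (u r \<xi> i)) f = 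
          (if Suc i \<in> N r then tri r (Suc i) i * cinner X (u r \<xi> (Suc i)) f else 0)"
        using Suc.prems(3) by (intro cinner_A1_u[OF a]) auto
      also have "\<dots> = 0"
        using Suc.prems(4)[OF a(1,2)] cinner_cnj[of X f "u r \<xi> (Suc i)"] by auto
      finally show "cinner X ?g (u r \<xi> i) = 0" by simp
    qed (use Suc.prems in auto)
    have "harmonic S (Suc i) (\<lambda>y. f (vert y))"
      unfolding harmonic_def
    proof (intro allI impI)
      fix w assume w: "w \<subseteq> S" "Suc (card w) = Suc i"
      have lw: "level (vert w) = i" using level_vert[OF w(1)] w Suc.prems(1) by simp
      have "0 = mat_vec X (fc_A D p 1) f (vert w)" using fun_cong[OF g0, of "vert w"] lw by simp
      also have "\<dots> = (\<Sum>z\<in>w. f (vert (w - {z}))) + (\<Sum>z\<in>S - w. f (vert (insert z w)))"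
        by (rule mat_vec_A1[OF w(1)])
      \<comment> \<open>\<open>f\<close> is supported on level \<open>Suc i\<close>, so the removals
        contribute nothing and the insertions alone give the harmonicity condition.\<close>
      also have "(\<Sum>z\<in>w. f (vert (w - {z}))) = 0"
      proof (intro sum.neutral ballI)
        fix z assume z: "z \<in> w"
        have "card (w - {z}) \<le> i" using w card_Diff1_le[of w z] by simp
        moreover have "w - {z} \<subseteq> S" using w by auto
        ultimately have "level (vert (w - {z})) \<le> i" using level_vert[of "w - {z}"] Suc.prems(1) by simp
        then show "f (vert (w - {z})) = 0" using Suc.prems(3)[of "vert (w - {z})"] by simp
      qed
      finally show "(\<Sum>z\<in>S - w. f (vert (insert z w))) = 0" by simp
    qed
    then show ?case using Suc.prems by (intro fin[of "Suc i" f])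
  }
qed

text \<open>Restricting \<open>f\<close> to one level keeps its inner products with the basis
  vectors of that level, so the levels can be treated separately.\<close>

lemma complete_u:
  assumes f: "f \<in> vecs X"
    and orth: "\<And>r \<xi> i. r \<in> R \<Longrightarrow> \<xi> \<in> B r \<Longrightarrow> i \<in> N r \<Longrightarrow> cinner X f (u r \<xi> i) = 0"
  shows "f = 0"
proof
  fix x
  show "f x = 0 x"
  proof (cases "x \<in> X")
    case True
    let ?g = "\<lambda>y. if level y = level x then f y else 0"
    obtain w where "w \<subseteq> S" "card w \<le> D" "x = vert w" using vert_cases[OF True] by blast
    then have "level x \<le> D" using level_vert by simp
    then have g0: "?g = 0"
    proof (rule complete_level)
      show "?g \<in> vecs X" using f by (auto simp: vecs_def)
      fix r \<xi> assume a: "r \<in> R" "\<xi> \<in> B r" "level x \<in> N r"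
      have "cinner X ?g (u r \<xi> (level x)) = cinner X f (u r \<xi> (level x))"
        unfolding cinner_def using u_level[of _ "level x" r \<xi>] by (intro sum.cong) auto
      then show "cinner X ?g (u r \<xi> (level x)) = 0" using orth[OF a] by simp
    qed simp
    then show ?thesis using fun_cong[OF g0, of x] by simp
  qed (use f in \<open>auto simp: vecs_def\<close>)
qed

text \<open>
  The witness is the coefficient family of \<open>\<Prod>\<^sub>k\<^sub><\<^sub>r (e\<^sub>2\<^sub>k\<^sub>+\<^sub>1 - e\<^sub>2\<^sub>k\<^sub>+\<^sub>2)\<close>.
\<close>

lemma L_nonzero:
  assumes r: "r < D"
  shows "\<exists>\<xi>\<in>fc_L D p r. \<xi> \<noteq> 0"
proof -
  define c where "c y k = (of_bool (2 * k + 1 \<in> y) - of_bool (2 * k + 2 \<in> y) :: complex)"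
    for y :: "nat set" and k
  define g where "g y = (\<Prod>k<r. c y k)" for y
  define \<xi> where "\<xi> x = (if x \<in> X \<and> level x = r then g (fst (p x)) else 0)" for x
  have \<xi>_vert: "\<xi> (vert y) = g y" if y: "y \<subseteq> S" "card y = r" for y
    using y r level_vert[of y] p_vert_less[of y] by (simp add: \<xi>_def)
  have "harmonic S r (\<lambda>y. \<xi> (vert y))"
    unfolding harmonic_def
  proof (intro allI impI)
    fix y assume y: "y \<subseteq> S" "Suc (card y) = r"
    have finy: "finite y" using y finite_sub by blast
    \<comment> \<open>Pigeonhole: \<open>(e - 1) div 2\<close> is the index of the pair
      \<open>{2k + 1, 2k + 2}\<close> containing \<open>e\<close>, and \<open>r - 1\<close> points
      miss one of \<open>r\<close> pairs. Adding a point outside the missed pair leaves a zero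
      factor; its two points give opposite values.\<close>
    have "card ((\<lambda>e. (e - 1) div 2) ` y) < card {..<r}"
      using card_image_le[OF finy, of "\<lambda>e. (e - 1) div 2"] y by simp
    then obtain k where k: "k < r" "k \<notin> (\<lambda>e. (e - 1) div 2) ` y"
      using card_mono[of "(\<lambda>e. (e - 1) div 2) ` y" "{..<r}"] finy
      by (meson finite_imageI lessThan_iff not_less subsetI)
    have "(2 * k + 1 - 1) div 2 = k" "(2 * k + 2 - 1) div 2 = k" by simp_all
    then have ny: "2 * k + 1 \<notin> y" "2 * k + 2 \<notin> y" using k(2) by (metis image_eqI)+
    have inS: "2 * k + 1 \<in> S" "2 * k + 2 \<in> S" using k r by (auto simp: ground_def)
    have gz: "g (insert z y) = 0" if "z \<noteq> 2 * k + 1" "z \<noteq> 2 * k + 2" for z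
    proof -
      have "c (insert z y) k = 0" using that ny by (auto simp: c_def)
      then show ?thesis using k(1) by (auto simp: g_def prod_zero_iff)
    qed
    have "g (insert (2 * k + 2) y) = - g (insert (2 * k + 1) y)"
    proof -
      have split: "g v = c v k * (\<Prod>m\<in>{..<r} - {k}. c v m)" for v
        unfolding g_def using k(1) by (subst prod.remove[of _ k]) auto
      have "(\<Prod>m\<in>{..<r} - {k}. c (insert (2 * k + 2) y) m) = (\<Prod>m\<in>{..<r} - {k}. c (insert (2 * k + 1) y) m)"
      proof (intro prod.cong refl)
        fix m assume "m \<in> {..<r} - {k}"
        then have m: "m \<noteq> k" by simp
        have "2 * m + 1 \<noteq> 2 * k + 1" "2 * m + 1 \<noteq> 2 * k + 2" "2 * m + 2 \<noteq> 2 * k + 1" "2 * m + 2 \<noteq> 2 * k + 2"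
          using m by presburger+
        then show "c (insert (2 * k + 2) y) m = c (insert (2 * k + 1) y) m"
          by (simp add: c_def)
      qed
      moreover have "c (insert (2 * k + 2) y) k = - c (insert (2 * k + 1) y) k"
        using ny by (simp add: c_def)
      ultimately show ?thesis by (simp only: split) simp
    qed
    moreover have "(\<Sum>z\<in>S - y. \<xi> (vert (insert z y))) = (\<Sum>z\<in>S - y. g (insert z y))"
      using y finy by (intro sum.cong refl \<xi>_vert) auto
    moreover have "\<dots> = (\<Sum>z\<in>{2 * k + 1, 2 * k + 2}. g (insert z y))"
      using gz ny inS by (intro sum.mono_neutral_right) auto
    ultimately show "(\<Sum>z\<in>S - y. \<xi> (vert (insert z y))) = 0" by simp
  qed
  then have "\<xi> \<in> fc_L D p r"
    unfolding L_iff_harmonic[OF r] by (auto simp: vecs_def \<xi>_def)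
  moreover have "\<xi> \<noteq> 0"
  proof -
    let ?y = "(\<lambda>k. 2 * k + 1) ` {..<r}"
    have "?y \<subseteq> S" using r by (auto simp: ground_def)
    moreover have "card ?y = r" by (subst card_image) (auto simp: inj_on_def)
    ultimately have "\<xi> (vert ?y) = g ?y" by (rule \<xi>_vert)
    also have "\<dots> = 1"
      unfolding g_def
    proof (intro prod.neutral ballI)
      fix k assume "k \<in> {..<r}"
      moreover have "2 * k + 2 \<noteq> 2 * m + 1" for m by presburger
      ultimately show "c ?y k = 1" by (auto simp: c_def)
    qed
    finally show ?thesis by auto
  qed
  ultimately show ?thesis by blast
qed

text \<open>With an empty \<open>B r\<close> there would be no vectors for block \<open>r\<close> to
  act on, and \<open>C r\<close> could not be recovered from \<open>M\<close>.\<close>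

lemma B_not_empty:
  assumes "r \<in> R"
  shows "B r \<noteq> {}"
proof
  assume "B r = {}"
  then have "fc_L D p r = cspan {}" using basis[of r] assms by (simp add: orthonormal_basis_def)
  then show False using L_nonzero[OF R_less[OF assms]] by (auto simp: cfun.span_empty)
qed

lemma fc_u_real:
  assumes "r \<in> R" "\<xi> \<in> B r"
  shows "u r \<xi> i x \<in> \<real>"
proof -
  have "fc_M D p i r r x y \<in> \<real>" for y by (simp add: fc_M_def)
  then show ?thesis
    using assms real[of r \<xi>] by (auto simp: fc_u_def mat_vec_def intro!: Reals_mult sum_in_Reals)
qed

sublocale adapted_basis X R B N u
  using cinner_u complete_u u_in_vecs B_not_empty finite_N fc_u_real
  by unfold_locales auto

end

section \<open>The Terwilliger algebra\<close>

context folded_cube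
begin

lemma dist_zero: "x \<in> X \<Longrightarrow> fc_dist p (fc_zero D) x = level x"
proof -
  assume "x \<in> X"
  then obtain w where w: "w \<subseteq> S" "card w \<le> D" "x = vert w" using vert_cases by blast
  have "fc_zero D = vert {}" by (simp add: fc_zero_def vert_def)
  then show ?thesis using dist_vert[of "{}" w] level_vert[OF w(1,2)] w by simp
qed

lemma A_0: "fc_A D p 0 = mat_one X"
proof (intro ext)
  fix x y
  show "fc_A D p 0 x y = mat_one X x y"
  proof (cases "x \<in> X \<and> y \<in> X")
    case True
    then obtain w w' where w: "w \<subseteq> S" "x = vert w" "w' \<subseteq> S" "y = vert w'" by (auto simp: verts_eq)
    have sub: "sym_diff w w' \<subseteq> S" using w by auto
    have "fc_dist p x y = 0 \<longleftrightarrow> card (sym_diff w w') = 0 \<or> card (S - sym_diff w w') = 0"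
      using dist_vert[OF w(1,3)] card_compl[OF sub] w by (auto simp: min_def)
    also have "\<dots> \<longleftrightarrow> sym_diff w w' = {} \<or> S - sym_diff w w' = {}"
      using finite_sub[OF sub] by simp
    also have "\<dots> \<longleftrightarrow> w' = w \<or> w' = S - w" using w by blast
    also have "\<dots> \<longleftrightarrow> x = y" using vert_eq_iff[OF w(1,3)] w by simp
    finally show ?thesis using True by (simp add: fc_A_def mat_one_def)
  qed (auto simp: fc_A_def mat_one_def)
qed

text \<open>The intersection numbers of the folded cube: \<open>Suc k\<close> neighbours are closer
  at distance \<open>Suc k\<close>, \<open>2 * D - k + 1\<close> are farther at distance
  \<open>k - 1\<close>, and none is at equal distance. At distance \<open>D\<close> all
  \<open>2 * D\<close> neighbours are closer.\<close>

lemma A_recurrence: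
  assumes k: "1 \<le> k" "Suc k \<le> D"
  shows "mat_mult X (fc_A D p 1) (fc_A D p k) =
    mat_scale (of_nat (if Suc k = D then 2 * D else Suc k)) (fc_A D p (Suc k)) +
    mat_scale (of_nat (2 * D - k + 1)) (fc_A D p (k - 1))" (is "_ = ?rhs")
proof (intro ext)
  fix x y
  show "mat_mult X (fc_A D p 1) (fc_A D p k) x y = ?rhs x y"
  proof (cases "x \<in> X \<and> y \<in> X")
    case False
    then show ?thesis by (auto simp: mat_mult_def mat_scale_def fc_A_def)
  next
    case True
    then obtain w v where w: "w \<subseteq> S" "x = vert w" and v: "v \<subseteq> S" "y = vert v" by (auto simp: verts_eq)
    \<comment> \<open>The half of \<open>y\<close> that is nearer to \<open>w\<close>, so that the
      size of the symmetric difference is the distance.\<close>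
    obtain w' where w': "w' \<subseteq> S" "y = vert w'" "card (sym_diff w w') \<le> D"
    proof (cases "card (sym_diff w v) \<le> D")
      case False
      have "sym_diff w (S - v) = S - sym_diff w v" using w v by auto
      moreover have "sym_diff w v \<subseteq> S" using w v by auto
      ultimately have "card (sym_diff w (S - v)) \<le> D" using False card_compl by simp
      then show ?thesis using that[of "S - v"] v vert_compl by auto
    qed (use that v in blast)
    define d where "d = sym_diff w w'"
    let ?m = "card d" and ?F = "\<lambda>e. of_bool (min (card e) (2 * D - card e) = k) :: complex"
    have d: "d \<subseteq> S" "finite d" "?m \<le> D" using w w' finite_sub[of d] by (auto simp: d_def)
    have dist: "fc_dist p x y = ?m" using dist_vert[OF w(1) w'(1)] w w' d by (simp add: d_def)
    have "mat_mult X (fc_A D p 1) (fc_A D p k) x y = (\<Sum>z\<in>S. fc_A D p k (vert (toggle z w)) y)"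
      unfolding mat_mult_def w(2) by (rule sum_A1[OF w(1)])
    also have "\<dots> = (\<Sum>z\<in>S. ?F (toggle z d))"
    proof (intro sum.cong refl)
      fix z assume z: "z \<in> S"
      have "fc_dist p (vert (toggle z w)) y = min (card (toggle z d)) (2 * D - card (toggle z d))"
        unfolding w'(2) d_def dist_vert[OF toggle_sub[OF w(1) z] w'(1)] sym_diff_toggle ..
      then show "fc_A D p k (vert (toggle z w)) y = ?F (toggle z d)"
        using toggle_sub[OF w(1) z] True by (simp add: fc_A_def)
    qed
    also have "\<dots> = (\<Sum>z\<in>d. ?F (d - {z})) + (\<Sum>z\<in>S - d. ?F (insert z d))"
      by (rule sum_toggle[OF d(1)])
    also have "(\<Sum>z\<in>d. ?F (d - {z})) = (\<Sum>z\<in>d. of_bool (?m = Suc k))"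
    proof (intro sum.cong refl)
      fix z assume "z \<in> d"
      then have "Suc (card (d - {z})) = ?m" by (rule card_Suc_Diff1[OF d(2)])
      then show "?F (d - {z}) = of_bool (?m = Suc k)" using d(3) by (auto simp: min_def)
    qed
    \<comment> \<open>Adding a point to a \<open>D\<close>-set gives
      \<open>min (D + 1) (D - 1) = D - 1\<close>: the distance drops although the difference
      grows.\<close>
    also have "(\<Sum>z\<in>S - d. ?F (insert z d)) =
       (\<Sum>z\<in>S - d. of_bool (Suc ?m = k \<or> ?m = D \<and> Suc k = D))"
    proof (intro sum.cong refl)
      fix z assume "z \<in> S - d"
      then have c: "card (insert z d) = Suc ?m" using d by simp
      have "min (Suc ?m) (2 * D - Suc ?m) = k \<longleftrightarrow> Suc ?m = k \<or> ?m = D \<and> Suc k = D"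
        using d(3) k by (auto simp: min_def)
      then show "?F (insert z d) = of_bool (Suc ?m = k \<or> ?m = D \<and> Suc k = D)" unfolding c by simp
    qed
    finally have "mat_mult X (fc_A D p 1) (fc_A D p k) x y =
       of_nat (?m * of_bool (?m = Suc k) + (2 * D - ?m) * of_bool (Suc ?m = k \<or> ?m = D \<and> Suc k = D))"
      using card_compl[OF d(1)] by simp
    also have "?m * of_bool (?m = Suc k) + (2 * D - ?m) * of_bool (Suc ?m = k \<or> ?m = D \<and> Suc k = D) =
       (if Suc k = D then 2 * D else Suc k) * of_bool (?m = Suc k) + (2 * D - k + 1) * of_bool (?m = k - 1)"
    proof -
      have "?m = k - 1 \<longleftrightarrow> Suc ?m = k" using k by auto
      then show ?thesis using k by auto
    qed
    finally show ?thesis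
      using True dist by (auto simp: mat_scale_def fc_A_def)
  qed
qed

end

context folded_cube_basis
begin

lemma rep_Estar: "rep (fc_Estar D p k) (block_diag R N k (\<lambda>_. 1))"
proof -
  have "mat_vec X (fc_Estar D p k) (u r \<xi> j) =
      (\<lambda>x. \<Sum>i\<in>N r. block_diag R N k (\<lambda>_. 1) r i j * u r \<xi> i x)"
    if r: "r \<in> R" and j: "j \<in> N r" for r \<xi> j
  proof
    fix x
    have "mat_vec X (fc_Estar D p k) (u r \<xi> j) x = (\<Sum>y\<in>X. if y = x then of_bool (level x = k) * u r \<xi> j x else 0)"
      unfolding mat_vec_def by (intro sum.cong) (auto simp: fc_Estar_def dist_zero)
    also have "\<dots> = of_bool (level x = k) * u r \<xi> j x"
      using u_in_vecs[of r \<xi> j] by (auto simp: vecs_def)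
    also have "\<dots> = of_bool (j = k) * u r \<xi> j x"
      using u_level[of x j r \<xi>] by (cases "level x = j") auto
    also have "\<dots> = (\<Sum>i\<in>N r. if i = j then of_bool (j = k) * u r \<xi> j x else 0)"
      using j finite_N by simp
    also have "\<dots> = (\<Sum>i\<in>N r. block_diag R N k (\<lambda>_. 1) r i j * u r \<xi> i x)"
      using r j by (intro sum.cong) (auto simp: block_diag_def)
    finally show "mat_vec X (fc_Estar D p k) (u r \<xi> j) x =
      (\<Sum>i\<in>N r. block_diag R N k (\<lambda>_. 1) r i j * u r \<xi> i x)" .
  qed
  moreover have "fc_Estar D p k \<in> mats X" by (auto simp: mats_def fc_Estar_def)
  moreover have "block_diag R N k (\<lambda>_. 1) \<in> block_sum R N"
    by (auto simp: block_sum_def block_diag_def mats_def fun_eq_iff)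
  ultimately show ?thesis unfolding rep_def by blast
qed

lemma A_mats: "fc_A D p k \<in> mats X"
  by (auto simp: mats_def fc_A_def)

lemma rep_A1: "rep (fc_A D p 1) tri"
proof -
  have "tri \<in> block_sum R N"
    by (auto simp: block_sum_def block_tridiag_def mats_def fun_eq_iff)
  then show ?thesis unfolding rep_def using A1_u B_L A_mats by blast
qed

text \<open>The recurrence is solved for the distance matrix of highest index, whose coefficient is
  nonzero.\<close>

lemma A_rep: "k \<le> D \<Longrightarrow> \<exists>C. rep (fc_A D p k) C"
proof (induction k rule: less_induct)
  case (less k)
  consider "k = 0" | "k = 1" | m where "k = Suc m" "1 \<le> m"
    by (metis One_nat_def Suc_le_eq not0_implies_Suc not_gr_zero)
  then show ?case
  proof cases
    case 1
    then show ?thesis using A_0 rep_one by auto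
  next
    case 2
    then show ?thesis using rep_A1 by auto
  next
    case 3
    obtain C C' where C: "rep (fc_A D p m) C" "rep (fc_A D p (m - 1)) C'"
      using less 3 by (metis Suc_leD diff_le_self le_imp_less_Suc less_imp_diff_less order.trans lessI)
    define c b :: complex where "c = of_nat (if Suc m = D then 2 * D else Suc m)" and "b = of_nat (2 * D - m + 1)"
    have c0: "c \<noteq> 0" using D_ge_3 unfolding c_def of_nat_eq_0_iff by auto
    have rec: "mat_mult X (fc_A D p 1) (fc_A D p m) = mat_scale c (fc_A D p k) + mat_scale b (fc_A D p (m - 1))"
      using A_recurrence[of m] 3 less.prems by (simp only: c_def b_def)
    have "fc_A D p k = mat_scale (1 / c) (mat_mult X (fc_A D p 1) (fc_A D p m) +
        mat_scale (- b) (fc_A D p (m - 1)))"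
      unfolding rec using c0 by (simp add: mat_scale_def fun_eq_iff)
    moreover have "rep \<dots> (block_scale (1 / c) (block_mult N tri C + block_scale (- b) C'))"
      by (intro rep_scale rep_add rep_mult rep_A1 C)
    ultimately show ?thesis by metis
  qed
qed

section \<open>The image of the Terwilliger algebra in the direct sum\<close>

abbreviation "T \<equiv> terwilliger D p"

lemma T_subalgebra: "mat_subalgebra X T"
  unfolding terwilliger_def
  by (rule mat_subalgebra_generated) (auto simp: mats_def fc_Estar_def fc_A_def)

lemma T_rep: "M \<in> T \<Longrightarrow> \<exists>C. rep M C"
proof -
  have "fc_A D p ` {0..D} \<union> fc_Estar D p ` {0..D} \<subseteq> {M. \<exists>C. rep M C}"
    using A_rep rep_Estar by auto
  from generated_algebra_least[OF mat_subalgebra_rep this] show "M \<in> T \<Longrightarrow> \<exists>C. rep M C"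
    by (auto simp: terwilliger_def)
qed

lemma T_generators: "k \<le> D \<Longrightarrow> fc_A D p k \<in> T" "k \<le> D \<Longrightarrow> fc_Estar D p k \<in> T"
  using generated_algebra_superset[of "fc_A D p ` {0..D} \<union> fc_Estar D p ` {0..D}" X]
  by (auto simp: terwilliger_def)

text \<open>The images of \<open>A\<^sub>1\<close> and the \<open>E\<^sup>*\<^sub>k\<close> already
  generate the full sum; \<open>e\<close> is the top index of a block, which depends on the parity
  of \<open>r\<close>.\<close>

lemma T_rep_image: "{C. \<exists>M\<in>T. rep M C} = block_sum R N"
proof (rule block_subalgebra_eq_block_sum[where e = "\<lambda>r. if even r then D else D - 1"
      and a = "\<lambda>r i. complex_of_real (alpha r i)"])
  show "block_subalgebra R N {C. \<exists>M\<in>T. rep M C}" by (rule block_subalgebra_rep_image[OF T_subalgebra])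
  show "block_diag R N k (\<lambda>_. 1) \<in> {C. \<exists>M\<in>T. rep M C}" if "k \<in> N r" for r k
    using T_generators(2)[of k] rep_Estar[of k] N_le[OF that] by blast
  show "tri \<in> {C. \<exists>M\<in>T. rep M C}" using T_generators(1)[of 1] rep_A1 D_ge_3 by auto
  show "complex_of_real (alpha r i) \<noteq> 0" if "i \<in> N r" "Suc i \<in> N r" for r i
    using alpha_N that by simp
qed (use D_ge_3 in \<open>auto simp: fc_N_def\<close>)

lemma idx_eq: "idx = fc_B2 D B"
  unfolding idx_def fc_B2_def by auto

lemma U_eq: "U = fc_U2 D p"
  by (simp add: U_def fc_U2_def)

end

theorem theorem4p8:
  fixes D :: nat
    and p :: "vertex \<Rightarrow> nat set \<times> nat set"
    and B :: "nat \<Rightarrow> (vertex \<Rightarrow> complex) set"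
  assumes "D \<ge> 3" and "odd D"
    and "fc_labelling D p"
    and "\<And>r. r \<le> D - 1 \<Longrightarrow> orthonormal_basis (fc_verts D) (fc_L D p r) (B r)"
    and "\<And>r \<xi> x. r \<le> D - 1 \<Longrightarrow> \<xi> \<in> B r \<Longrightarrow> \<xi> x \<in> \<real>"
  shows
    "let X = fc_verts D; T = terwilliger D p; U = fc_U2 D p; I = fc_B2 D B;
         UMU = (\<lambda>M. mat_mult X (mat_mult X (mat_transpose U) M) U)
     in (inj_on (\<lambda>b x. U x b) I \<and> orthonormal_basis X (vecs X) ((\<lambda>b x. U x b) ` I)) \<and>
        (\<forall>M\<in>T.
           (\<forall>(r, \<xi>, i)\<in>I. \<forall>(r', \<xi>', j)\<in>I.
              (r, \<xi>) \<noteq> (r', \<xi>') \<longrightarrow> UMU M (r, \<xi>, i) (r', \<xi>', j) = 0) \<and>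
           (\<forall>r\<le>D - 1. \<forall>\<xi>\<in>B r. \<forall>\<xi>'\<in>B r. \<forall>i\<in>fc_N D r. \<forall>j\<in>fc_N D r.
              UMU M (r, \<xi>, i) (r, \<xi>, j) = UMU M (r, \<xi>', i) (r, \<xi>', j))) \<and>
        isomorphic_to_block_sum X T {0..D - 1} (fc_N D)"
proof -
  interpret F: folded_cube_basis D p B
    by unfold_locales (fact assms)+
  let ?UMU = "\<lambda>M. mat_mult (fc_verts D) (mat_mult (fc_verts D) (mat_transpose (fc_U2 D p)) M) (fc_U2 D p)"
  have blocks: "\<exists>C. \<forall>r \<xi> i s \<eta> j. (r, \<xi>, i) \<in> fc_B2 D B \<longrightarrow> (s, \<eta>, j) \<in> fc_B2 D B \<longrightarrow>
      ?UMU M (r, \<xi>, i) (s, \<eta>, j) = (if (r, \<xi>) = (s, \<eta>) then C r i j else 0)"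
    if M: "M \<in> terwilliger D p" for M
  proof -
    obtain C where "F.rep M C" using F.T_rep[OF M] by blast
    then show ?thesis using F.rep_entry unfolding F.idx_eq F.U_eq by blast
  qed
  have "(\<forall>(r, \<xi>, i)\<in>fc_B2 D B. \<forall>(r', \<xi>', j)\<in>fc_B2 D B.
              (r, \<xi>) \<noteq> (r', \<xi>') \<longrightarrow> ?UMU M (r, \<xi>, i) (r', \<xi>', j) = 0) \<and>
        (\<forall>r\<le>D - 1. \<forall>\<xi>\<in>B r. \<forall>\<xi>'\<in>B r. \<forall>i\<in>fc_N D r. \<forall>j\<in>fc_N D r.
              ?UMU M (r, \<xi>, i) (r, \<xi>, j) = ?UMU M (r, \<xi>', i) (r, \<xi>', j))"
    if M: "M \<in> terwilliger D p" for M
  proof -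
    obtain C where C: "\<And>r \<xi> i s \<eta> j. (r, \<xi>, i) \<in> fc_B2 D B \<Longrightarrow> (s, \<eta>, j) \<in> fc_B2 D B \<Longrightarrow>
      ?UMU M (r, \<xi>, i) (s, \<eta>, j) = (if (r, \<xi>) = (s, \<eta>) then C r i j else 0)"
      using blocks[OF M] by metis
    have "(r, \<xi>, i) \<in> fc_B2 D B" if "r \<le> D - 1" "\<xi> \<in> B r" "i \<in> fc_N D r" for r \<xi> i
      using that by (simp add: fc_B2_def)
    with C show ?thesis by auto
  qed
  moreover have "inj_on (\<lambda>b x. fc_U2 D p x b) (fc_B2 D B)"
    "orthonormal_basis (fc_verts D) (vecs (fc_verts D)) ((\<lambda>b x. fc_U2 D p x b) ` fc_B2 D B)"
    using F.inj_U F.orthonormal_basis_U unfolding F.idx_eq F.U_eq by auto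
  moreover have "isomorphic_to_block_sum (fc_verts D) (terwilliger D p) {0..D - 1} (fc_N D)"
    by (rule F.isomorphic_to_block_sum_of_rep[OF F.T_subalgebra F.T_rep F.T_rep_image])
  ultimately show ?thesis unfolding Let_def by blast
qed

end
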